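(* Let $\alpha\in(0,1]$, let $\gamma=\sup\{i\alpha:i\in\mathbb N,\ i\alpha\le1\}$, and let $N\in\mathbb N$ with $N>\gamma/\alpha$. Let $\mathbf V$ be a branched $\alpha$-rough path over $N$ particles in $\mathbb R^d$, with increments $\mathbf V_{s,t}$. Let $(\Omega,\mathcal F,\mathbb P)$ be a probability space carrying a random variable $u:\Omega\to\{1,\dots,N\}$ with $\mathbb P\circ u^{-1}$ uniform, and let $(\mathbf p,\mathbf q)$ be a dual integrability functional on $\mathscr F^{\gamma,\alpha,\alpha}$. For $i\in\{1,\dots,N\}$, $T=(\mathscr N^T,\mathscr E^T,h_0^T,H^T)\in\mathscr F_0^{\gamma,\alpha,\alpha}$ and $\omega_{H^T}=(\omega_h)_{h\in H^T}\in\Omega^{\times|H^T|}$, let $\mathfrak R_i[T,\omega_{H^T}]=(\mathscr N^T,\mathscr E^T,\mathfrak L)$ be the directed forest labelled by $$\mathfrak L(x)=i\ \text{ if }x\in h_0^T,\qquad \mathfrak L(x)=u(\omega_h)\ \text{ if }x\in h\in H^T,$$ and set $\langle\mathbf W_{s,t},T\rangle(i,\omega_{H^T})=\langle\mathbf V_{s,t},\mathfrak R_i[T,\omega_{H^T}]\rangle$. Let $\mathbf W_{s,t}(u)$ denote the family of functions $(\omega_0,\omega_{H^T})\mapsto\langle\mathbf W_{s,t},T\rangle(u(\omega_0),\omega_{H^T})$, $T\in\mathscr F_0^{\gamma,\alpha,\alpha}$. Then for each $s,t\in[0,1]$, $$\mathbf W_{s,t}(u)\in G_{\mathbf q}^{\gamma,\alpha,\alpha}\big(L^0(\Omega,\mathbb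 P;\mathbb R^e)\big).$$ Further, the collection $(\mathbf W_{s,t}(u))_{s,t\in[0,1]}$ satisfies $\mathbf W_{s,t}(u)=(\mathbf W_{0,s}(u))^{-1}\ast\mathbf W_{0,t}(u)$ and $\mathbf W_{r,s}(u)\ast\mathbf W_{s,t}(u)=\mathbf W_{r,t}(u)$ $\mathbb P$-a.s. for all $r,s,t\in[0,1]$, and for all $T\in\mathscr F^{\gamma,\alpha,\alpha}$ $$\sup_{s,t\in[0,1]}\frac{\mathbb E^{H^T}\big[|\langle\mathbf W_{s,t}(u),T\rangle(\omega_0,\omega_{H^T})|\big]}{|t-s|^{\alpha|\mathscr N^T|}}<\infty\qquad\text{for }\mathbb P\text{-a.e. }\omega_0,$$ ($\mathbb E^{H^T}$ being the expectation in $\omega_{H^T}$ under $\mathbb P^{\times|H^T|}$); that is, $t\mapsto\mathbf W_{0,t}(u)$ is a McKean–Vlasov probabilistic rough path.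
   Context: **Branched rough path over $N$ particles.** Let $\mathfrak F_{0,N}$ be the set of directed forests $\tau=(\mathscr N,\mathscr E,\mathscr L)$ (finite, components are trees with edges directed towards the root), up to isomorphism, with node labels $\mathscr L:\mathscr N\to\{1,\dots,N\}$, including the empty forest $\mathbf 1$; $\mathfrak F_{0,N}^{\gamma,\alpha}=\{\tau:\alpha|\mathscr N^\tau|\le\gamma\}$; $\tau_1\odot\tau_2$ is the disjoint union. A branched $\alpha$-rough path is a path taking values in the characters of the associated truncated Butcher–Connes–Kreimer Hopf algebra; its increments $\mathbf V_{s,t}=(\mathbf V_s)^{-1}\ast\mathbf V_t$ form a family $\langle\mathbf V_{s,t},\tau\rangle\in(\mathbb R^d)^{\otimes|\mathscr N^\tau|}$ (tensor factors indexed by nodes, compatible with isomorphisms), $\tau\in\mathfrak F_{0,N}^{\gamma,\alpha}$, $s,t\in[0,1]$, with $\langle\mathbf V_{s,t},\mathbf 1\rangle=1$, $\langle\mathbf V_{s,t},\tau_1\odot\tau_2\rangle=\langle\mathbf V_{s,t},\tau_1\rangle\otimes\langle\mathbf V_{s,t},\tau_2\rangle$, Chen's relation $\langle\mathbf V_{r,t},\tau\rangle=\sum_R\langle\mathbf V_{r,s},\tau|_{\mathscr N^\tau\setminus R}\rangle\otimes\langle\mathbf V_{s,t},\tau|_R\rangle$ (sum over subsets $R\subseteq\mathscr N^\tau$ that are ancestor-closed, i.e. $y\in R$, $(y,z)\in\mathscr E^\tau$ imply $z\in R$; $\tau|_A$ is the induced labelled forest), and $\sup_{s,t}|\langle\mathbf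 V_{s,t},\tau\rangle|/|t-s|^{\alpha|\mathscr N^\tau|}<\infty$. **Lions forests.** For a directed forest $(\mathscr N,\mathscr E)$, the depth of a node is the number of nodes on its unique path to a root; write $x\le y$ if $\mathrm{depth}(x)\le\mathrm{depth}(y)$ and $x<y$ if the inequality is strict. A Lions forest is $T=(\mathscr N,\mathscr E,h_0,H)$ where $\mathscr N\neq\emptyset$, $(\mathscr N,\mathscr E)$ is a directed forest, $h_0\subseteq\mathscr N$ (possibly empty), $H$ is a partition of $\mathscr N\setminus h_0$ and, with $H'=(H\cup\{h_0\})\setminus\{\emptyset\}$: (i) if $h_0\ne\emptyset$ there is $x\in h_0$ with $x\le y$ for all $y\in\mathscr N$; (ii) if $h\in H'$, $x,y\in h$ and $x<y$, there is $z\in h$ with $(y,z)\in\mathscr E$; (iii) if $h\in H'$, $x_1,y_1\in h$ have equal depth, $(x_1,x_2),(y_1,y_2)\in\mathscr E$ and $x_2\ne y_2$, then $x_2,y_2\in h$. $\mathscr F$ is the set of Lions forests, $\mathbf 1$ the empty forest, $\mathscr F_0=\mathscr F\cup\{\mathbf 1\}$. Lions forests are considered up to isomorphism; all families indexed by Lions forests are understood to be compatible with isomorphisms. **Operations and truncation.** $T_1\circledast T_2=(\mathscr N^{T_1}\sqcup\mathscr N^{T_2},\mathscr E^{T_1}\sqcup\mathscr E^{T_2},h_0^{T_1}\sqcup h_0^{T_2},H^{T_1}\sqcup H^{T_2})$. Decoupling: $\mathcal E[T]=(\mathscr N^T,\mathscr E^T,\emptyset,(H^T\cup\{h_0^T\})\setminus\{\emptyset\})$.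 $\mathscr F^{\gamma,\alpha,\alpha}=\{T\in\mathscr F:\alpha|\mathscr N^T|\le\gamma\}$, $\mathscr F_0^{\gamma,\alpha,\alpha}=\mathscr F^{\gamma,\alpha,\alpha}\cup\{\mathbf 1\}$. For $A\subseteq\mathscr N^T$ let $T|_A=(A,\mathscr E^T\cap(A\times A),h_0^T\cap A,\{h\cap A:h\in H^T\}\setminus\{\emptyset\})$; for $R$ ancestor-closed, $T|_R$ and $T|_{\mathscr N^T\setminus R}$ are in $\mathscr F_0$. **Dual integrability functional.** A pair of families $\mathbf p=(p[T])$, $\mathbf q=(q[T])$ indexed by $T\in\mathscr F^{\gamma,\alpha,\alpha}$, with $p[T],q[T]\in(1,\infty)^{H^T}$, such that: $1/p[T]_h+1/q[T]_h=1$; $p[T_1\circledast T_2]=(p[T_1],p[T_2])$ and likewise for $q$ whenever $T_1\circledast T_2\in\mathscr F^{\gamma,\alpha,\alpha}$; and for every $T$, ancestor-closed $R$, $h\in H^T$, with $\Upsilon=T|_{\mathscr N^T\setminus R}$, $Y=T|_R$, one has $1/q[T]_h\ge 1/q[\Upsilon]_{h\cap\mathscr N^\Upsilon}+1/q[Y]_{h\cap\mathscr N^Y}$, where a term is omitted if the corresponding intersection is empty. **McKean–Vlasov characters.** $G_{\mathbf q}^{\gamma,\alpha,\alpha}(L^0(\Omega,\mathbb P;\mathbb R^e))$ ($e$ plays no role) is the set of families $f=(\langle f,T\rangle)_{T\in\mathscr F_0^{\gamma,\alpha,\alpha}}$ of (a.e. classes of) measurable functions $\langle f,T\rangle:\Omega\times\Omega^{\times|H^T|}\to(\mathbb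 R^d)^{\otimes|\mathscr N^T|}$ (tensor factors indexed by nodes), written $\langle f,T\rangle(\omega_0,\omega_{H^T})$, such that: $\langle f,T\rangle(\omega_0,\cdot)$ lies for a.e. $\omega_0$ in the mixed-norm space $L^{q[T]}(\Omega^{\times|H^T|})$ with exponent $q[T]_h$ in $\omega_h$ (no order of integration privileged); $\langle f,\mathbf 1\rangle=1$; $\langle f,T_1\circledast T_2\rangle(\omega_0,\omega_{H^{T_1}},\omega_{H^{T_2}})=\langle f,T_1\rangle(\omega_0,\omega_{H^{T_1}})\otimes\langle f,T_2\rangle(\omega_0,\omega_{H^{T_2}})$ a.s. whenever $T_1\circledast T_2\in\mathscr F^{\gamma,\alpha,\alpha}$; for $h_0^T\ne\emptyset$, $\langle f,T\rangle(\omega_{h_0^T},\omega_{H^T})=\langle f,\mathcal E[T]\rangle(\omega_0,\omega_{h_0^T},\omega_{H^T})$ for $\mathbb P\times\mathbb P^{\times|H^{\mathcal E[T]}|}$-a.e. argument (so that $\langle f,T\rangle$ does not depend on $\omega_0$ when $h_0^T=\emptyset$). It is a group under $$\langle f\ast g,T\rangle(\omega_0,\omega_{H^T})=\sum_{R\subseteq\mathscr N^T\text{ ancestor-closed}}\langle f,T|_{\mathscr N^T\setminus R}\rangle\otimes^{H^T}\langle g,T|_R\rangle(\omega_0,\omega_{H^T}),$$ where $\otimes^{H^T}$ means that in each factor the variable attached to the hyperedge $h\cap(\mathscr N^T\setminus R)$ (resp. $h\cap R$), $h\in H^T$, is set equal to $\omega_h$ and both factors share $\omega_0$; the unit is $\epsilon$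 ($\langle\epsilon,\mathbf 1\rangle=1$, $\langle\epsilon,T\rangle=0$ otherwise). **McKean–Vlasov probabilistic rough path** (for $\alpha=\beta$): a path $[0,1]\to G_{\mathbf q}^{\gamma,\alpha,\alpha}$ whose increments satisfy the two relations and the regularity bound displayed in the claim. *)

theory Defs
  imports "HOL-Probability.Probability"
begin

section \<open>Tensors with factors indexed by nodes\<close>

text \<open>
  An element of the tensor power of \<open>\<real>\<^sup>d\<close> whose factors are indexed by a finite set \<open>A\<close> of nodes is
  given by its coordinates in the standard basis: one real number for every multi-index
  \<open>j : A \<rightarrow> {1,\<dots>,d}\<close>.  The finite type \<open>'d\<close> plays the role of \<open>{1,\<dots>,d}\<close> (as in \<^typ>\<open>real ^ 'd\<close>).
  Coordinates at anything that is not such a multi-index are zero, so that equality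
  of tensors is equality of functions.  No order of the nodes is involved.
\<close>

type_synonym 'd tensor = "(nat \<Rightarrow> 'd) \<Rightarrow> real"

abbreviation multi_indices :: "nat set \<Rightarrow> (nat \<Rightarrow> 'd) set" where
  "multi_indices A \<equiv> A \<rightarrow>\<^sub>E UNIV"

definition tensor_space :: "nat set \<Rightarrow> 'd tensor set" where
  "tensor_space A = {a. \<forall>j. j \<notin> multi_indices A \<longrightarrow> a j = 0}"

definition tensor_prod :: "nat set \<Rightarrow> nat set \<Rightarrow> 'd tensor \<Rightarrow> 'd tensor \<Rightarrow> 'd tensor" where
  "tensor_prod A B a b =
     (\<lambda>j. if j \<in> multi_indices (A \<union> B) then a (restrict j A) * b (restrict j B) else 0)"

text \<open>The number 1 in the zeroth tensor power, i.e. in \<open>\<real>\<close>.\<close>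

definition tensor_one :: "'d tensor" where
  "tensor_one = (\<lambda>j. if j \<in> multi_indices {} then 1 else 0)"

definition tensor_norm :: "nat set \<Rightarrow> 'd::finite tensor \<Rightarrow> real" where
  "tensor_norm A a = sqrt (\<Sum>j\<in>multi_indices A. (a j)\<^sup>2)"

text \<open>Transport of a tensor over \<open>A\<close> along an injection \<open>\<phi>\<close> of \<open>A\<close>: the factor at \<open>x\<close> becomes the factor
  at \<open>\<phi> x\<close>.\<close>

definition tensor_map :: "(nat \<Rightarrow> nat) \<Rightarrow> nat set \<Rightarrow> 'd tensor \<Rightarrow> 'd tensor" where
  "tensor_map \<phi> A a =
     (\<lambda>j. if j \<in> multi_indices (\<phi> ` A) then a (\<lambda>x\<in>A. j (\<phi> x)) else 0)"


section \<open>Directed forests\<close>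

text \<open>
  Forests considered up to isomorphism are represented by concrete forests whose nodes are natural
  numbers; families indexed by forests are then required to be compatible with isomorphisms.
\<close>

record forest =
  nodes :: "nat set"
  edges :: "(nat \<times> nat) set"

definition root_path :: "(nat \<times> nat) set \<Rightarrow> nat \<Rightarrow> nat list \<Rightarrow> bool" where
  "root_path E x xs \<longleftrightarrow>
     xs \<noteq> [] \<and> hd xs = x \<and> successively (\<lambda>y z. (y, z) \<in> E) xs \<and> last xs \<notin> Domain E"

text \<open>
  A root is a node without outgoing edge.  That every node has exactly one directed walk to a root
  says that the components are trees with all edges directed towards the root.
\<close>

definition directed_forest :: "'z forest_scheme \<Rightarrow> bool" where
  "directed_forest F \<longleftrightarrow>
     finite (nodes F) \<and> edges F \<subseteq> nodes F \<times> nodes F \<and>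
     (\<forall>x\<in>nodes F. \<exists>!xs. root_path (edges F) x xs)"

definition depth :: "'z forest_scheme \<Rightarrow> nat \<Rightarrow> nat" where
  "depth F x = length (THE xs. root_path (edges F) x xs)"

definition ancestor_closed :: "'z forest_scheme \<Rightarrow> nat set set" where
  "ancestor_closed F = {R. R \<subseteq> nodes F \<and> (\<forall>y z. y \<in> R \<and> (y, z) \<in> edges F \<longrightarrow> z \<in> R)}"

definition forest_iso :: "(nat \<Rightarrow> nat) \<Rightarrow> 'y forest_scheme \<Rightarrow> 'z forest_scheme \<Rightarrow> bool" where
  "forest_iso \<phi> F F' \<longleftrightarrow>
     bij_betw \<phi> (nodes F) (nodes F') \<and> edges F' = map_prod \<phi> \<phi> ` edges F"


section \<open>Branched rough paths over finitely many particles\<close>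

text \<open>Only the values of the label function at the nodes matter; families indexed by labelled forests
  ignore the other values because they are compatible with isomorphisms.\<close>

record labelled_forest = forest +
  label :: "nat \<Rightarrow> nat"

definition labelled_iso :: "(nat \<Rightarrow> nat) \<Rightarrow> labelled_forest \<Rightarrow> labelled_forest \<Rightarrow> bool" where
  "labelled_iso \<phi> \<tau> \<tau>' \<longleftrightarrow> forest_iso \<phi> \<tau> \<tau>' \<and> (\<forall>x\<in>nodes \<tau>. label \<tau>' (\<phi> x) = label \<tau> x)"

definition labelled_forests :: "nat \<Rightarrow> real \<Rightarrow> real \<Rightarrow> labelled_forest set" where
  "labelled_forests N \<gamma> \<alpha> =
     {\<tau>. directed_forest \<tau> \<and> (\<forall>x\<in>nodes \<tau>. label \<tau> x \<in> {1..N}) \<and> \<alpha> * real (card (nodes \<tau>)) \<le> \<gamma>}"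

text \<open>Meaningful for disjoint sets of nodes.\<close>

definition labelled_union :: "labelled_forest \<Rightarrow> labelled_forest \<Rightarrow> labelled_forest" where
  "labelled_union \<tau>1 \<tau>2 =
     \<lparr>nodes = nodes \<tau>1 \<union> nodes \<tau>2, edges = edges \<tau>1 \<union> edges \<tau>2,
      label = (\<lambda>x. if x \<in> nodes \<tau>1 then label \<tau>1 x else label \<tau>2 x)\<rparr>"

definition labelled_restrict :: "labelled_forest \<Rightarrow> nat set \<Rightarrow> labelled_forest" where
  "labelled_restrict \<tau> A = \<lparr>nodes = A, edges = edges \<tau> \<inter> A \<times> A, label = label \<tau>\<rparr>"

type_synonym 'd labelled_family = "labelled_forest \<Rightarrow> 'd tensor"

definition branched_characters :: "nat \<Rightarrow> real \<Rightarrow> real \<Rightarrow> 'd labelled_family set" where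
  "branched_characters N \<gamma> \<alpha> = {f.
     (\<forall>\<tau>\<in>labelled_forests N \<gamma> \<alpha>. f \<tau> \<in> tensor_space (nodes \<tau>)) \<and>
     (\<forall>\<tau>\<in>labelled_forests N \<gamma> \<alpha>. \<forall>\<tau>'\<in>labelled_forests N \<gamma> \<alpha>. \<forall>\<phi>.
        labelled_iso \<phi> \<tau> \<tau>' \<longrightarrow> f \<tau>' = tensor_map \<phi> (nodes \<tau>) (f \<tau>)) \<and>
     (\<forall>\<tau>\<in>labelled_forests N \<gamma> \<alpha>. nodes \<tau> = {} \<longrightarrow> f \<tau> = tensor_one) \<and>
     (\<forall>\<tau>1\<in>labelled_forests N \<gamma> \<alpha>. \<forall>\<tau>2\<in>labelled_forests N \<gamma> \<alpha>.
        nodes \<tau>1 \<inter> nodes \<tau>2 = {} \<and> labelled_union \<tau>1 \<tau>2 \<in> labelled_forests N \<gamma> \<alpha> \<longrightarrow>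
        f (labelled_union \<tau>1 \<tau>2) = tensor_prod (nodes \<tau>1) (nodes \<tau>2) (f \<tau>1) (f \<tau>2))}"

definition branched_conv :: "'d labelled_family \<Rightarrow> 'd labelled_family \<Rightarrow> 'd labelled_family" where
  "branched_conv f g \<tau> = (\<lambda>j. \<Sum>R\<in>ancestor_closed \<tau>.
     tensor_prod (nodes \<tau> - R) R
       (f (labelled_restrict \<tau> (nodes \<tau> - R))) (g (labelled_restrict \<tau> R)) j)"

definition branched_unit :: "'d labelled_family" where
  "branched_unit \<tau> = (if nodes \<tau> = {} then tensor_one else (\<lambda>_. 0))"

definition branched_inverse :: "nat \<Rightarrow> real \<Rightarrow> real \<Rightarrow> 'd labelled_family \<Rightarrow> 'd labelled_family" where
  "branched_inverse N \<gamma> \<alpha> f = (SOME g. g \<in> branched_characters N \<gamma> \<alpha> \<and>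
     (\<forall>\<tau>\<in>labelled_forests N \<gamma> \<alpha>.
        branched_conv f g \<tau> = branched_unit \<tau> \<and> branched_conv g f \<tau> = branched_unit \<tau>))"

definition branched_increment ::
    "nat \<Rightarrow> real \<Rightarrow> real \<Rightarrow> (real \<Rightarrow> 'd labelled_family) \<Rightarrow> real \<Rightarrow> real \<Rightarrow> 'd labelled_family" where
  "branched_increment N \<gamma> \<alpha> V s t = branched_conv (branched_inverse N \<gamma> \<alpha> (V s)) (V t)"

definition branched_rough_path ::
    "nat \<Rightarrow> real \<Rightarrow> real \<Rightarrow> (real \<Rightarrow> 'd::finite labelled_family) \<Rightarrow> bool" where
  "branched_rough_path N \<gamma> \<alpha> V \<longleftrightarrow>
     (\<forall>t\<in>{0..1}. V t \<in> branched_characters N \<gamma> \<alpha>) \<and>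
     (\<forall>s\<in>{0..1}. \<forall>t\<in>{0..1}. branched_increment N \<gamma> \<alpha> V s t \<in> branched_characters N \<gamma> \<alpha>) \<and>
     (\<forall>r\<in>{0..1}. \<forall>s\<in>{0..1}. \<forall>t\<in>{0..1}. \<forall>\<tau>\<in>labelled_forests N \<gamma> \<alpha>.
        branched_increment N \<gamma> \<alpha> V r t \<tau> =
        branched_conv (branched_increment N \<gamma> \<alpha> V r s) (branched_increment N \<gamma> \<alpha> V s t) \<tau>) \<and>
     (\<forall>\<tau>\<in>labelled_forests N \<gamma> \<alpha>. bdd_above
        {tensor_norm (nodes \<tau>) (branched_increment N \<gamma> \<alpha> V s t \<tau>) /
           \<bar>t - s\<bar> powr (\<alpha> * real (card (nodes \<tau>))) | s t. s \<in> {0..1} \<and> t \<in> {0..1} \<and> s \<noteq> t})"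


section \<open>Lions forests\<close>

record lions_forest = forest +
  hyp0 :: "nat set"
  hyps :: "nat set set"

definition lions_forests :: "lions_forest set" where
  "lions_forests = {T. nodes T \<noteq> {} \<and> directed_forest T \<and> hyp0 T \<subseteq> nodes T \<and>
     partition_on (nodes T - hyp0 T) (hyps T) \<and>
     (hyp0 T \<noteq> {} \<longrightarrow> (\<exists>x\<in>hyp0 T. \<forall>y\<in>nodes T. depth T x \<le> depth T y)) \<and>
     (\<forall>h\<in>insert (hyp0 T) (hyps T) - {{}}.
        (\<forall>x\<in>h. \<forall>y\<in>h. depth T x < depth T y \<longrightarrow> (\<exists>z\<in>h. (y, z) \<in> edges T)) \<and>
        (\<forall>x1\<in>h. \<forall>y1\<in>h. \<forall>x2 y2. depth T x1 = depth T y1 \<and>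
           (x1, x2) \<in> edges T \<and> (y1, y2) \<in> edges T \<and> x2 \<noteq> y2 \<longrightarrow> x2 \<in> h \<and> y2 \<in> h))}"

definition empty_lions :: lions_forest where
  "empty_lions = \<lparr>nodes = {}, edges = {}, hyp0 = {}, hyps = {}\<rparr>"

definition trunc_lions_forests :: "real \<Rightarrow> real \<Rightarrow> lions_forest set" where
  "trunc_lions_forests \<gamma> \<alpha> = {T \<in> lions_forests. \<alpha> * real (card (nodes T)) \<le> \<gamma>}"

definition trunc_lions_forests0 :: "real \<Rightarrow> real \<Rightarrow> lions_forest set" where
  "trunc_lions_forests0 \<gamma> \<alpha> = insert empty_lions (trunc_lions_forests \<gamma> \<alpha>)"

definition lions_iso :: "(nat \<Rightarrow> nat) \<Rightarrow> lions_forest \<Rightarrow> lions_forest \<Rightarrow> bool" where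
  "lions_iso \<phi> T T' \<longleftrightarrow> forest_iso \<phi> T T' \<and> hyp0 T' = \<phi> ` hyp0 T \<and> hyps T' = (`) \<phi> ` hyps T"

text \<open>Meaningful for disjoint sets of nodes.\<close>

definition lions_prod :: "lions_forest \<Rightarrow> lions_forest \<Rightarrow> lions_forest" where
  "lions_prod T1 T2 = \<lparr>nodes = nodes T1 \<union> nodes T2, edges = edges T1 \<union> edges T2,
     hyp0 = hyp0 T1 \<union> hyp0 T2, hyps = hyps T1 \<union> hyps T2\<rparr>"

definition decouple :: "lions_forest \<Rightarrow> lions_forest" where
  "decouple T = \<lparr>nodes = nodes T, edges = edges T,
     hyp0 = {}, hyps = insert (hyp0 T) (hyps T) - {{}}\<rparr>"

definition lions_restrict :: "lions_forest \<Rightarrow> nat set \<Rightarrow> lions_forest" where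
  "lions_restrict T A = \<lparr>nodes = A, edges = edges T \<inter> A \<times> A,
     hyp0 = hyp0 T \<inter> A, hyps = (\<lambda>h. h \<inter> A) ` hyps T - {{}}\<rparr>"


section \<open>Dual integrability functionals\<close>

definition dual_integrability_functional :: "real \<Rightarrow> real \<Rightarrow>
    (lions_forest \<Rightarrow> nat set \<Rightarrow> real) \<Rightarrow> (lions_forest \<Rightarrow> nat set \<Rightarrow> real) \<Rightarrow> bool" where
  "dual_integrability_functional \<gamma> \<alpha> p q \<longleftrightarrow>
     (\<forall>T\<in>trunc_lions_forests \<gamma> \<alpha>. \<forall>h\<in>hyps T.
        1 < p T h \<and> 1 < q T h \<and> 1 / p T h + 1 / q T h = 1) \<and>
     (\<forall>T\<in>trunc_lions_forests \<gamma> \<alpha>. \<forall>T'\<in>trunc_lions_forests \<gamma> \<alpha>. \<forall>\<phi>. lions_iso \<phi> T T' \<longrightarrow>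
        (\<forall>h\<in>hyps T. p T' (\<phi> ` h) = p T h \<and> q T' (\<phi> ` h) = q T h)) \<and>
     (\<forall>T1\<in>lions_forests. \<forall>T2\<in>lions_forests.
        nodes T1 \<inter> nodes T2 = {} \<and> lions_prod T1 T2 \<in> trunc_lions_forests \<gamma> \<alpha> \<longrightarrow>
        (\<forall>h\<in>hyps T1. p (lions_prod T1 T2) h = p T1 h \<and> q (lions_prod T1 T2) h = q T1 h) \<and>
        (\<forall>h\<in>hyps T2. p (lions_prod T1 T2) h = p T2 h \<and> q (lions_prod T1 T2) h = q T2 h)) \<and>
     (\<forall>T\<in>trunc_lions_forests \<gamma> \<alpha>. \<forall>R\<in>ancestor_closed T. \<forall>h\<in>hyps T.
        1 / q T h \<ge>
          (if h \<inter> (nodes T - R) = {} then 0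
           else 1 / q (lions_restrict T (nodes T - R)) (h \<inter> (nodes T - R))) +
          (if h \<inter> R = {} then 0 else 1 / q (lions_restrict T R) (h \<inter> R)))"


section \<open>McKean--Vlasov characters\<close>

text \<open>
  The argument \<open>\<omega>\<close> of a member \<open>f T \<omega>0 \<omega>\<close> of a family is an element of the product of copies of the
  probability space indexed by the hyperedges of \<open>T\<close>.
\<close>

type_synonym ('w, 'd) lions_family = "lions_forest \<Rightarrow> 'w \<Rightarrow> (nat set \<Rightarrow> 'w) \<Rightarrow> 'd tensor"

abbreviation hyp_measure :: "'w measure \<Rightarrow> lions_forest \<Rightarrow> (nat set \<Rightarrow> 'w) measure" where
  "hyp_measure M T \<equiv> PiM (hyps T) (\<lambda>_. M)"

definition ennreal_root_power :: "ennreal \<Rightarrow> real \<Rightarrow> ennreal" where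
  "ennreal_root_power x a = (if x = \<infinity> then \<infinity> else ennreal (enn2real x powr a))"

text \<open>
  The mixed norm of \<open>F\<close> for the order of integration given by a list of variables, the head of the
  list being the outermost one.  Membership in the mixed-norm space is required for every order.
\<close>

fun iterated_norm :: "'w measure \<Rightarrow> ('h \<Rightarrow> real) \<Rightarrow> 'h list \<Rightarrow> (('h \<Rightarrow> 'w) \<Rightarrow> ennreal) \<Rightarrow> ('h \<Rightarrow> 'w) \<Rightarrow> ennreal" where
  "iterated_norm M q [] F \<omega> = F \<omega>"
| "iterated_norm M q (h # hs) F \<omega> = ennreal_root_power
     (\<integral>\<^sup>+x. ennreal_root_power (iterated_norm M q hs F (fun_upd \<omega> h x)) (q h) \<partial>M) (1 / q h)"

definition mixed_norm_finite :: "'w measure \<Rightarrow> ('h \<Rightarrow> real) \<Rightarrow> 'h set \<Rightarrow> (('h \<Rightarrow> 'w) \<Rightarrow> ennreal) \<Rightarrow> bool" where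
  "mixed_norm_finite M q H F \<longleftrightarrow>
     (\<forall>hs. distinct hs \<and> set hs = H \<longrightarrow> iterated_norm M q hs F (\<lambda>_. undefined) < \<infinity>)"

definition mv_characters :: "'w measure \<Rightarrow> real \<Rightarrow> real \<Rightarrow> (lions_forest \<Rightarrow> nat set \<Rightarrow> real) \<Rightarrow>
    ('w, 'd::finite) lions_family set" where
  "mv_characters M \<gamma> \<alpha> q = {f.
     (\<forall>T\<in>trunc_lions_forests0 \<gamma> \<alpha>.
        (\<forall>\<omega>0\<in>space M. \<forall>\<omega>\<in>space (hyp_measure M T). f T \<omega>0 \<omega> \<in> tensor_space (nodes T)) \<and>
        (\<forall>j. (\<lambda>(\<omega>0, \<omega>). f T \<omega>0 \<omega> j) \<in> borel_measurable (M \<Otimes>\<^sub>M hyp_measure M T)) \<and>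
        (AE \<omega>0 in M. mixed_norm_finite M (q T) (hyps T)
           (\<lambda>\<omega>. ennreal (tensor_norm (nodes T) (f T \<omega>0 \<omega>))))) \<and>
     (\<forall>T\<in>trunc_lions_forests0 \<gamma> \<alpha>. \<forall>T'\<in>trunc_lions_forests0 \<gamma> \<alpha>. \<forall>\<phi>. lions_iso \<phi> T T' \<longrightarrow>
        (AE (\<omega>0, \<omega>) in M \<Otimes>\<^sub>M hyp_measure M T'.
           f T' \<omega>0 \<omega> = tensor_map \<phi> (nodes T) (f T \<omega>0 (\<lambda>h\<in>hyps T. \<omega> (\<phi> ` h))))) \<and>
     (AE (\<omega>0, \<omega>) in M \<Otimes>\<^sub>M hyp_measure M empty_lions. f empty_lions \<omega>0 \<omega> = tensor_one) \<and>
     (\<forall>T1\<in>trunc_lions_forests0 \<gamma> \<alpha>. \<forall>T2\<in>trunc_lions_forests0 \<gamma> \<alpha>.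
        nodes T1 \<inter> nodes T2 = {} \<and> lions_prod T1 T2 \<in> trunc_lions_forests \<gamma> \<alpha> \<longrightarrow>
        (AE (\<omega>0, \<omega>) in M \<Otimes>\<^sub>M hyp_measure M (lions_prod T1 T2).
           f (lions_prod T1 T2) \<omega>0 \<omega> = tensor_prod (nodes T1) (nodes T2)
             (f T1 \<omega>0 (restrict \<omega> (hyps T1))) (f T2 \<omega>0 (restrict \<omega> (hyps T2))))) \<and>
     (\<forall>T\<in>trunc_lions_forests \<gamma> \<alpha>. hyp0 T \<noteq> {} \<longrightarrow>
        (AE (\<omega>0, \<omega>) in M \<Otimes>\<^sub>M hyp_measure M (decouple T).
           f T (\<omega> (hyp0 T)) (restrict \<omega> (hyps T)) = f (decouple T) \<omega>0 \<omega>))}"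

definition mv_eq :: "'w measure \<Rightarrow> real \<Rightarrow> real \<Rightarrow>
    ('w, 'd) lions_family \<Rightarrow> ('w, 'd) lions_family \<Rightarrow> bool" where
  "mv_eq M \<gamma> \<alpha> f g \<longleftrightarrow> (\<forall>T\<in>trunc_lions_forests0 \<gamma> \<alpha>.
     AE (\<omega>0, \<omega>) in M \<Otimes>\<^sub>M hyp_measure M T. f T \<omega>0 \<omega> = g T \<omega>0 \<omega>)"

text \<open>The variable of \<open>T\<close> restricted to \<open>A\<close> attached to the hyperedge \<open>h \<inter> A\<close> is set equal to \<open>\<omega> h\<close>; the
  hyperedge \<open>h\<close> is determined by \<open>h \<inter> A \<noteq> {}\<close> since hyperedges are disjoint.\<close>

definition pull_vars :: "lions_forest \<Rightarrow> nat set \<Rightarrow> (nat set \<Rightarrow> 'w) \<Rightarrow> nat set \<Rightarrow> 'w" where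
  "pull_vars T A \<omega> = (\<lambda>k\<in>hyps (lions_restrict T A). \<omega> (THE h. h \<in> hyps T \<and> h \<inter> A = k))"

definition mv_conv ::
    "('w, 'd) lions_family \<Rightarrow> ('w, 'd) lions_family \<Rightarrow> ('w, 'd) lions_family" where
  "mv_conv f g T \<omega>0 \<omega> = (\<lambda>j. \<Sum>R\<in>ancestor_closed T.
     tensor_prod (nodes T - R) R
       (f (lions_restrict T (nodes T - R)) \<omega>0 (pull_vars T (nodes T - R) \<omega>))
       (g (lions_restrict T R) \<omega>0 (pull_vars T R \<omega>)) j)"

definition mv_unit :: "('w, 'd) lions_family" where
  "mv_unit T \<omega>0 \<omega> = (if T = empty_lions then tensor_one else (\<lambda>_. 0))"

text \<open>Inverses are unique up to a.e. equality.\<close>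

definition mv_inverse :: "'w measure \<Rightarrow> real \<Rightarrow> real \<Rightarrow> (lions_forest \<Rightarrow> nat set \<Rightarrow> real) \<Rightarrow>
    ('w, 'd::finite) lions_family \<Rightarrow> ('w, 'd) lions_family" where
  "mv_inverse M \<gamma> \<alpha> q f = (SOME g. g \<in> mv_characters M \<gamma> \<alpha> q \<and>
     mv_eq M \<gamma> \<alpha> (mv_conv f g) mv_unit \<and> mv_eq M \<gamma> \<alpha> (mv_conv g f) mv_unit)"


section \<open>McKean--Vlasov probabilistic rough paths\<close>

definition mv_regular :: "'w measure \<Rightarrow> real \<Rightarrow> real \<Rightarrow>
    (real \<Rightarrow> real \<Rightarrow> ('w, 'd::finite) lions_family) \<Rightarrow> bool" where
  "mv_regular M \<gamma> \<alpha> Y \<longleftrightarrow> (\<forall>T\<in>trunc_lions_forests \<gamma> \<alpha>. AE \<omega>0 in M.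
     (SUP (s, t)\<in>{(s, t). s \<in> {0..1} \<and> t \<in> {0..1} \<and> s \<noteq> t}.
        (\<integral>\<^sup>+\<omega>. ennreal (tensor_norm (nodes T) (Y s t T \<omega>0 \<omega>)) \<partial>hyp_measure M T) /
        ennreal (\<bar>t - s\<bar> powr (\<alpha> * real (card (nodes T))))) < \<infinity>)"

text \<open>
  The increments of a path are a.e. classes, whereas the regularity bound, a supremum over an
  uncountable set inside an a.e. statement, refers to representatives; these form the family \<open>Y\<close>.
\<close>

definition mv_rough_path :: "'w measure \<Rightarrow> real \<Rightarrow> real \<Rightarrow> (lions_forest \<Rightarrow> nat set \<Rightarrow> real) \<Rightarrow>
    (real \<Rightarrow> ('w, 'd::finite) lions_family) \<Rightarrow> bool" where
  "mv_rough_path M \<gamma> \<alpha> q X \<longleftrightarrow>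
     (\<forall>t\<in>{0..1}. X t \<in> mv_characters M \<gamma> \<alpha> q) \<and>
     (\<exists>Y. (\<forall>s\<in>{0..1}. \<forall>t\<in>{0..1}. Y s t \<in> mv_characters M \<gamma> \<alpha> q \<and>
             mv_eq M \<gamma> \<alpha> (Y s t) (mv_conv (mv_inverse M \<gamma> \<alpha> q (X s)) (X t)) \<and>
             mv_eq M \<gamma> \<alpha> (Y s t) (mv_conv (mv_inverse M \<gamma> \<alpha> q (Y 0 s)) (Y 0 t))) \<and>
          (\<forall>r\<in>{0..1}. \<forall>s\<in>{0..1}. \<forall>t\<in>{0..1}.
             mv_eq M \<gamma> \<alpha> (mv_conv (Y r s) (Y s t)) (Y r t)) \<and>
          mv_regular M \<gamma> \<alpha> Y)"


section \<open>From particle labels to Lions forests\<close>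

definition relabel :: "('w \<Rightarrow> nat) \<Rightarrow> nat \<Rightarrow> lions_forest \<Rightarrow> (nat set \<Rightarrow> 'w) \<Rightarrow> labelled_forest" where
  "relabel u i T \<omega> = \<lparr>nodes = nodes T, edges = edges T,
     label = (\<lambda>x. if x \<in> hyp0 T then i else u (\<omega> (THE h. h \<in> hyps T \<and> x \<in> h)))\<rparr>"

definition particle_family :: "('w \<Rightarrow> nat) \<Rightarrow> 'd labelled_family \<Rightarrow>
    lions_forest \<Rightarrow> nat \<Rightarrow> (nat set \<Rightarrow> 'w) \<Rightarrow> 'd tensor" where
  "particle_family u v T i \<omega> = v (relabel u i T \<omega>)"

definition random_particle_family :: "('w \<Rightarrow> nat) \<Rightarrow> 'd labelled_family \<Rightarrow> ('w, 'd) lions_family" where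
  "random_particle_family u v T \<omega>0 \<omega> = particle_family u v T (u \<omega>0) \<omega>"

end

theory Submission
  imports Defs
begin

text \<open>
  The label of a node of \<open>T\<close> depends only on the hyperedge containing it, so relabelling turns the
  operations on Lions forests (restriction, product, decoupling, isomorphism) into the corresponding
  operations on labelled forests; multiplicativity and Chen's relation for \<open>W\<close> are then pointwise
  consequences of those for \<open>V\<close>, and integrability and regularity hold because \<open>u\<close> takes finitely
  many values.  A character with \<open>v = v \<ast> v\<close> is the unit, so \<open>W s s\<close> is the unit and
  \<open>W s 0\<close> is a two-sided inverse of \<open>W 0 s\<close>.  Inverses are a.e. unique because left
  multiplication by a character is triangular in the number of nodes.
\<close>

section \<open>Directed forests and restrictions of Lions forests\<close>

text \<open>The obstacle is the inverse. \<open>mv_inverse\<close> is a choice among two-sided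
  inverses, so only its specification can be used; cancellation on the left compares it with the
  inverse supplied by Chen's relation, which avoids associativity of \<open>mv_conv\<close>. This is
  also where the geometry of Lions forests enters. \<open>mv_eq\<close> compares families only on
  truncated Lions forests. Replacing the left factor of a convolution almost everywhere therefore
  requires the complement of an ancestor-closed set to carry a Lions forest again, and the induction
  behind cancellation requires the same of the set itself. The relation between convolutions of
  \<open>W\<close> and of \<open>V\<close>, by contrast, is pointwise and holds for restrictions to
  arbitrary sets of nodes. Of \<open>V\<close>, only three facts about increments are used: they are
  characters, they satisfy Chen's relation, and they obey the bound. The choice hidden in
  \<open>branched_inverse\<close> is never opened.\<close>

lemma root_path_iff:
  "root_path E x xs \<longleftrightarrow>
     xs = [x] \<and> x \<notin> Domain E \<or> (\<exists>y ys. xs = x # ys \<and> (x, y) \<in> E \<and> root_path E y ys)"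
  by (cases xs; cases "tl xs") (auto simp: root_path_def)

text \<open>Induction along the edges: a node in \<open>Domain E\<close> has exactly one successor,
  and prepending the node to the unique walk of that successor gives its own unique walk.\<close>

lemma ex1_root_path:
  assumes "single_valued E" and "wf (E\<inverse>)"
  shows "\<exists>!xs. root_path E x xs"
  using assms(2)
proof (induction x rule: wf_induct_rule)
  case (less x)
  show ?case
  proof (cases "x \<in> Domain E")
    case True
    then obtain y where y: "(x, y) \<in> E" by blast
    obtain ys where ys: "root_path E y ys" "\<And>zs. root_path E y zs \<Longrightarrow> zs = ys"
      using less[of y] y by blast
    have "root_path E x (x # ys)"
      using y ys(1) by (subst root_path_iff) blast
    moreover have "xs = x # ys" if "root_path E x xs" for xs
      using that True y ys(2) single_valuedD[OF assms(1) y] by (subst (asm) root_path_iff) blast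
    ultimately show ?thesis by blast
  next
    case False
    then show ?thesis by (subst root_path_iff) blast
  qed
qed

lemma depth_edge:
  assumes "directed_forest F" and "(x, y) \<in> edges F"
  shows "depth F x = Suc (depth F y)"
proof -
  have xy: "x \<in> nodes F" "y \<in> nodes F"
    using assms by (auto simp: directed_forest_def)
  have "\<exists>!ys. root_path (edges F) y ys"
    using assms(1) xy(2) by (simp add: directed_forest_def)
  then obtain ys where ys: "root_path (edges F) y ys" "\<And>zs. root_path (edges F) y zs \<Longrightarrow> zs = ys"
    by blast
  have "root_path (edges F) x (x # ys)"
    using assms(2) ys(1) by (subst root_path_iff) blast
  then have "(THE xs. root_path (edges F) x xs) = x # ys"
    using assms(1) xy(1) by (intro the1_equality) (auto simp: directed_forest_def)
  moreover have "(THE ys. root_path (edges F) y ys) = ys"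
    using ys by blast
  ultimately show ?thesis by (simp add: depth_def)
qed

text \<open>Trades uniqueness of walks for conditions that pass to subsets of the edges. Two
  successors of a node would yield two walks, and depth drops strictly along edges, so cycles are
  impossible. Conversely, finiteness turns acyclicity into the well-foundedness behind
  \<open>ex1_root_path\<close>.\<close>

lemma directed_forest_iff:
  "directed_forest F \<longleftrightarrow>
     finite (nodes F) \<and> edges F \<subseteq> nodes F \<times> nodes F \<and> single_valued (edges F) \<and> acyclic (edges F)"
proof
  assume F: "directed_forest F"
  have "y = z" if e: "(x, y) \<in> edges F" "(x, z) \<in> edges F" for x y z
  proof -
    have nodes: "x \<in> nodes F" "y \<in> nodes F" "z \<in> nodes F"
      using F e by (auto simp: directed_forest_def)
    have ex1: "\<exists>!xs. root_path (edges F) w xs" if "w \<in> nodes F" for w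
      using F that by (simp add: directed_forest_def)
    obtain ys where ys: "root_path (edges F) y ys" using ex1[OF nodes(2)] by (rule ex1E)
    obtain zs where zs: "root_path (edges F) z zs" using ex1[OF nodes(3)] by (rule ex1E)
    have "root_path (edges F) x (x # ys)" "root_path (edges F) x (x # zs)"
      using e ys zs root_path_iff[of "edges F" x] by auto
    then have "ys = zs" using ex1[OF nodes(1)] by (metis list.inject)
    with ys zs show ?thesis by (auto simp: root_path_def)
  qed
  moreover have "depth F y < depth F x" if "(x, y) \<in> (edges F)\<^sup>+" for x y
    using that by induction (use depth_edge[OF F] in force)+
  ultimately have "single_valued (edges F)" "acyclic (edges F)"
    by (blast intro: single_valuedI, fastforce simp: acyclic_def)
  with F show "finite (nodes F) \<and> edges F \<subseteq> nodes F \<times> nodes F \<and> single_valued (edges F) \<and> acyclic (edges F)"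
    by (simp add: directed_forest_def)
next
  assume F: "finite (nodes F) \<and> edges F \<subseteq> nodes F \<times> nodes F \<and> single_valued (edges F) \<and> acyclic (edges F)"
  then have "finite (edges F)" by (meson finite_SigmaI finite_subset)
  with F have "wf ((edges F)\<inverse>)" by (simp add: finite_acyclic_wf_converse)
  with F ex1_root_path show "directed_forest F" by (auto simp: directed_forest_def)
qed

lemma depth_root:
  assumes "x \<notin> Domain (edges F)"
  shows "depth F x = 1"
proof -
  have "(THE xs. root_path (edges F) x xs) = [x]"
    using assms root_path_iff[of "edges F" x] by (intro the_equality) blast+
  then show ?thesis by (simp add: depth_def)
qed

lemma depth_pos: "directed_forest F \<Longrightarrow> 0 < depth F x"
  by (cases "x \<in> Domain (edges F)") (auto simp: depth_root depth_edge)

lemma depth_gt_1_edge: "1 < depth F x \<Longrightarrow> \<exists>y. (x, y) \<in> edges F"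
  using depth_root[of x F] by force

lemma depth_rtrancl:
  assumes "directed_forest F" and "(x, y) \<in> (edges F)\<^sup>*"
  shows "depth F y \<le> depth F x" and "depth F x = depth F y \<Longrightarrow> x = y"
proof -
  have "x = y \<or> depth F y < depth F x"
    using assms(2) by induction (auto simp: depth_edge[OF assms(1)])
  then show "depth F y \<le> depth F x" and "depth F x = depth F y \<Longrightarrow> x = y" by auto
qed

lemma directed_forest_subset:
  assumes "directed_forest F" and "nodes G \<subseteq> nodes F" and "edges G = edges F \<inter> nodes G \<times> nodes G"
  shows "directed_forest G"
proof -
  have "single_valued (edges G)" "acyclic (edges G)"
    using assms by (auto simp: directed_forest_iff intro: single_valued_subset acyclic_subset)
  with assms show ?thesis
    by (auto simp: directed_forest_iff intro: finite_subset)
qed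

section \<open>Restrictions of Lions forests to ancestor-closed sets and their complements\<close>

lemma lions_restrict_simps [simp]:
  "nodes (lions_restrict T A) = A"
  "edges (lions_restrict T A) = edges T \<inter> A \<times> A"
  "hyp0 (lions_restrict T A) = hyp0 T \<inter> A"
  "hyps (lions_restrict T A) = (\<lambda>h. h \<inter> A) ` hyps T - {{}}"
  by (simp_all add: lions_restrict_def)

lemma empty_lions_simps [simp]:
  "nodes empty_lions = {}" "edges empty_lions = {}" "hyp0 empty_lions = {}" "hyps empty_lions = {}"
  by (simp_all add: empty_lions_def)

lemma lions_restrict_empty [simp]: "lions_restrict T {} = empty_lions"
  by (auto simp: lions_restrict_def empty_lions_def)

lemma partition_on_Int:
  assumes "partition_on B P"
  shows "partition_on (B \<inter> A) ((\<lambda>h. h \<inter> A) ` P - {{}})"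
  using assms by (auto simp: partition_on_def disjoint_def)

lemma partition_on_lions_restrict:
  assumes "partition_on (nodes T - hyp0 T) (hyps T)" and "A \<subseteq> nodes T"
  shows "partition_on (A - hyp0 T \<inter> A) (hyps (lions_restrict T A))"
proof -
  have "(nodes T - hyp0 T) \<inter> A = A - hyp0 T \<inter> A" using assms(2) by blast
  with partition_on_Int[OF assms(1), of A] show ?thesis by simp
qed

text \<open>Conditions (ii) and (iii) hold vacuously for an empty block, so they are available on
  all of \<open>insert (hyp0 T) (hyps T)\<close>. Of (iii) one half is kept; the other follows by
  exchanging the two nodes.\<close>

lemma lions_forestsD:
  assumes "T \<in> lions_forests"
  shows "nodes T \<noteq> {}" "directed_forest T" "hyp0 T \<subseteq> nodes T"
    "partition_on (nodes T - hyp0 T) (hyps T)"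
    "hyp0 T \<noteq> {} \<Longrightarrow> \<exists>x\<in>hyp0 T. \<forall>y\<in>nodes T. depth T x \<le> depth T y"
    "\<And>h x y. h \<in> insert (hyp0 T) (hyps T) \<Longrightarrow> x \<in> h \<Longrightarrow> y \<in> h \<Longrightarrow> depth T x < depth T y \<Longrightarrow>
        \<exists>z\<in>h. (y, z) \<in> edges T"
    "\<And>h x1 y1 x2 y2. h \<in> insert (hyp0 T) (hyps T) \<Longrightarrow> x1 \<in> h \<Longrightarrow> y1 \<in> h \<Longrightarrow> depth T x1 = depth T y1 \<Longrightarrow>
        (x1, x2) \<in> edges T \<Longrightarrow> (y1, y2) \<in> edges T \<Longrightarrow> x2 \<noteq> y2 \<Longrightarrow> x2 \<in> h"
proof -
  show "nodes T \<noteq> {}" "directed_forest T" "hyp0 T \<subseteq> nodes T"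
    "partition_on (nodes T - hyp0 T) (hyps T)"
    "hyp0 T \<noteq> {} \<Longrightarrow> \<exists>x\<in>hyp0 T. \<forall>y\<in>nodes T. depth T x \<le> depth T y"
    using assms unfolding lions_forests_def mem_Collect_eq by (elim conjE; iprover)+
  have "(\<forall>x\<in>h. \<forall>y\<in>h. depth T x < depth T y \<longrightarrow> (\<exists>z\<in>h. (y, z) \<in> edges T)) \<and>
        (\<forall>x1\<in>h. \<forall>y1\<in>h. \<forall>x2 y2. depth T x1 = depth T y1 \<and>
           (x1, x2) \<in> edges T \<and> (y1, y2) \<in> edges T \<and> x2 \<noteq> y2 \<longrightarrow> x2 \<in> h \<and> y2 \<in> h)"
    if "h \<in> insert (hyp0 T) (hyps T)" for h
  proof (cases "h = {}")
    case False
    with that have "h \<in> insert (hyp0 T) (hyps T) - {{}}" by simp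
    with assms show ?thesis unfolding lions_forests_def mem_Collect_eq by (elim conjE) (rule bspec)
  qed simp
  note this = this[THEN conjunct1] this[THEN conjunct2]
  then show "\<And>h x y. h \<in> insert (hyp0 T) (hyps T) \<Longrightarrow> x \<in> h \<Longrightarrow> y \<in> h \<Longrightarrow> depth T x < depth T y \<Longrightarrow>
        \<exists>z\<in>h. (y, z) \<in> edges T"
    "\<And>h x1 y1 x2 y2. h \<in> insert (hyp0 T) (hyps T) \<Longrightarrow> x1 \<in> h \<Longrightarrow> y1 \<in> h \<Longrightarrow> depth T x1 = depth T y1 \<Longrightarrow>
        (x1, x2) \<in> edges T \<Longrightarrow> (y1, y2) \<in> edges T \<Longrightarrow> x2 \<noteq> y2 \<Longrightarrow> x2 \<in> h"
    by meson+
qed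

text \<open>Condition (i) says that a nonempty \<open>hyp0 T\<close> contains a root; by (ii) it can then be reached
  from every node of \<open>hyp0 T\<close> without leaving \<open>hyp0 T\<close>.\<close>

lemma hyp0_parent:
  assumes "T \<in> lions_forests" and "x \<in> hyp0 T" and "(x, y) \<in> edges T"
  shows "y \<in> hyp0 T"
proof -
  note T = lions_forestsD[OF assms(1)]
  have sv: "single_valued (edges T)" using T(2) by (simp add: directed_forest_iff)
  have "y \<in> nodes T" using T(2) assms(3) by (auto simp: directed_forest_iff)
  moreover obtain r where r: "r \<in> hyp0 T" "\<forall>y\<in>nodes T. depth T r \<le> depth T y"
    using T(5) assms(2) by blast
  ultimately have "depth T r < depth T x"
    using depth_edge[OF T(2) assms(3)] by fastforce
  then obtain z where "z \<in> hyp0 T" "(x, z) \<in> edges T"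
    using T(6)[of "hyp0 T" r x] r(1) assms(2) by blast
  then show ?thesis using sv assms(3) by (auto dest: single_valuedD)
qed

text \<open>Common core of both restrictions. Condition (i) survives for every \<open>A\<close>:
  climbing from a node of \<open>hyp0 T \<inter> A\<close> stays in that set by
  \<open>hyp0_parent\<close> and ends at a root of the restriction, where depth is minimal. In (ii)
  the deeper node cannot be a root, so its parent exists and only membership in the hyperedge is
  left as a premise.\<close>

lemma lions_forests_restrictI:
  assumes "T \<in> lions_forests" and "A \<subseteq> nodes T" and "A \<noteq> {}"
    and ii: "\<And>h x y z. h \<in> insert (hyp0 T) (hyps T) \<Longrightarrow> x \<in> h \<inter> A \<Longrightarrow> y \<in> h \<inter> A \<Longrightarrow> z \<in> A \<Longrightarrow>
        depth (lions_restrict T A) x < depth (lions_restrict T A) y \<Longrightarrow> (y, z) \<in> edges T \<Longrightarrow> z \<in> h"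
    and iii: "\<And>h x1 y1 x2 y2. h \<in> insert (hyp0 T) (hyps T) \<Longrightarrow> x1 \<in> h \<inter> A \<Longrightarrow> y1 \<in> h \<inter> A \<Longrightarrow> x2 \<in> A \<Longrightarrow> y2 \<in> A \<Longrightarrow>
        depth (lions_restrict T A) x1 = depth (lions_restrict T A) y1 \<Longrightarrow>
        (x1, x2) \<in> edges T \<Longrightarrow> (y1, y2) \<in> edges T \<Longrightarrow> x2 \<noteq> y2 \<Longrightarrow> x2 \<in> h"
  shows "lions_restrict T A \<in> lions_forests"
proof -
  let ?S = "lions_restrict T A"
  note T = lions_forestsD[OF assms(1)]
  have S: "directed_forest ?S"
    using T(2) by (rule directed_forest_subset) (use assms(2) in auto)
  have root: "\<exists>x\<in>hyp0 T \<inter> A. \<forall>y\<in>A. depth ?S x \<le> depth ?S y" if "x \<in> hyp0 T \<inter> A" for x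
    using that
  proof (induction "depth ?S x" arbitrary: x rule: less_induct)
    case less
    show ?case
    proof (cases "1 < depth ?S x")
      case True
      then obtain y where y: "(x, y) \<in> edges ?S" using depth_gt_1_edge by blast
      then have "y \<in> hyp0 T \<inter> A" using hyp0_parent[OF assms(1)] less.prems by auto
      with less.hyps[of y] show ?thesis using depth_edge[OF S y] by simp
    next
      case False
      then show ?thesis using less.prems depth_pos[OF S] by (metis less_one linorder_not_less not_less_iff_gr_or_eq order.order_iff_strict)
    qed
  qed
  have "(\<forall>x\<in>h \<inter> A. \<forall>y\<in>h \<inter> A. depth ?S x < depth ?S y \<longrightarrow> (\<exists>z\<in>h \<inter> A. (y, z) \<in> edges ?S)) \<and>
        (\<forall>x1\<in>h \<inter> A. \<forall>y1\<in>h \<inter> A. \<forall>x2 y2. depth ?S x1 = depth ?S y1 \<and>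
           (x1, x2) \<in> edges ?S \<and> (y1, y2) \<in> edges ?S \<and> x2 \<noteq> y2 \<longrightarrow> x2 \<in> h \<inter> A \<and> y2 \<in> h \<inter> A)"
    if h: "h \<in> insert (hyp0 T) (hyps T)" for h
  proof (intro conjI ballI allI impI, goal_cases)
    case (1 x y)
    then have "1 < depth ?S y" using depth_pos[OF S, of x] by linarith
    then obtain z where "(y, z) \<in> edges ?S" using depth_gt_1_edge by blast
    with ii[OF h 1(1,2), of z] 1(3) show ?case by auto
  next
    case (2 x1 y1 x2 y2)
    with iii[OF h 2(1,2), of x2 y2] show ?case by auto
  next
    case (3 x1 y1 x2 y2)
    with iii[OF h 3(2,1), of y2 x2] show ?case by auto
  qed
  note block = this
  have "\<forall>h\<in>insert (hyp0 ?S) (hyps ?S) - {{}}.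
     (\<forall>x\<in>h. \<forall>y\<in>h. depth ?S x < depth ?S y \<longrightarrow> (\<exists>z\<in>h. (y, z) \<in> edges ?S)) \<and>
     (\<forall>x1\<in>h. \<forall>y1\<in>h. \<forall>x2 y2. depth ?S x1 = depth ?S y1 \<and>
        (x1, x2) \<in> edges ?S \<and> (y1, y2) \<in> edges ?S \<and> x2 \<noteq> y2 \<longrightarrow> x2 \<in> h \<and> y2 \<in> h)"
  proof
    fix h' assume "h' \<in> insert (hyp0 ?S) (hyps ?S) - {{}}"
    then obtain h where "h \<in> insert (hyp0 T) (hyps T)" and h': "h' = h \<inter> A" by auto
    from block[OF this(1)] show "(\<forall>x\<in>h'. \<forall>y\<in>h'. depth ?S x < depth ?S y \<longrightarrow> (\<exists>z\<in>h'. (y, z) \<in> edges ?S)) \<and>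
      (\<forall>x1\<in>h'. \<forall>y1\<in>h'. \<forall>x2 y2. depth ?S x1 = depth ?S y1 \<and>
        (x1, x2) \<in> edges ?S \<and> (y1, y2) \<in> edges ?S \<and> x2 \<noteq> y2 \<longrightarrow> x2 \<in> h' \<and> y2 \<in> h')"
      unfolding h' .
  qed
  moreover have "hyp0 ?S \<noteq> {} \<longrightarrow> (\<exists>x\<in>hyp0 ?S. \<forall>y\<in>nodes ?S. depth ?S x \<le> depth ?S y)"
    unfolding lions_restrict_simps using root by blast
  moreover have "partition_on (nodes ?S - hyp0 ?S) (hyps ?S)"
    using partition_on_lions_restrict[OF T(4) assms(2)] by simp
  ultimately show ?thesis
    using assms(3) S unfolding lions_forests_def by (intro CollectI conjI) simp_all
qed

text \<open>The set \<open>R\<close> contains the whole walk from each of its nodes to the root, so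
  depths are those of \<open>T\<close> and conditions (ii) and (iii) are inherited.\<close>

lemma lions_restrict_closed:
  assumes "T \<in> lions_forests" and R: "R \<in> ancestor_closed T" and "R \<noteq> {}"
  shows "lions_restrict T R \<in> lions_forests"
proof -
  let ?S = "lions_restrict T R"
  note T = lions_forestsD[OF assms(1)]
  have sv: "single_valued (edges T)" using T(2) by (simp add: directed_forest_iff)
  have sub: "R \<subseteq> nodes T" and cl: "\<And>y z. y \<in> R \<Longrightarrow> (y, z) \<in> edges T \<Longrightarrow> z \<in> R"
    using R by (auto simp: ancestor_closed_def)
  have S: "directed_forest ?S"
    using T(2) by (rule directed_forest_subset) (use sub in auto)
  have dep: "depth ?S x = depth T x" if "x \<in> R" for x
    using that
  proof (induction "depth T x" arbitrary: x rule: less_induct)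
    case less
    show ?case
    proof (cases "x \<in> Domain (edges T)")
      case True
      then obtain y where y: "(x, y) \<in> edges T" by blast
      with cl less.prems have "(x, y) \<in> edges ?S" "y \<in> R" by auto
      then show ?thesis using less.hyps[of y] depth_edge[OF S, of x y] depth_edge[OF T(2) y] by simp
    next
      case False
      then have "x \<notin> Domain (edges ?S)" by auto
      with False show ?thesis by (metis depth_root)
    qed
  qed
  show ?thesis
  proof (rule lions_forests_restrictI[OF assms(1) sub assms(3)], goal_cases)
    case (1 h x y z)
    then have "\<exists>z\<in>h. (y, z) \<in> edges T"
      using T(6)[of h x y] dep by simp
    with 1 sv show ?case by (auto dest: single_valuedD)
  next
    case (2 h x1 y1 x2 y2)
    then show ?case using T(7)[of h x1 y1 x2 y2] dep by auto
  qed
qed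

text \<open>Condition (ii), applied repeatedly against the fixed node \<open>y\<close>: while
  \<open>x\<close> is deeper than \<open>y\<close>, its parent lies in \<open>h\<close>. Each edge
  lowers the depth by exactly one, so the climb cannot jump over the depth of
  \<open>y\<close>.\<close>

lemma hyperedge_climb:
  assumes "T \<in> lions_forests" and "h \<in> insert (hyp0 T) (hyps T)" and "y \<in> h"
    and "x \<in> h" and "depth T y \<le> depth T x"
  obtains w where "w \<in> h" "(x, w) \<in> (edges T)\<^sup>*" "depth T w = depth T y"
proof -
  note T = lions_forestsD[OF assms(1)]
  have "\<exists>w\<in>h. (x, w) \<in> (edges T)\<^sup>* \<and> depth T w = depth T y"
    using assms(4,5)
  proof (induction "depth T x" arbitrary: x rule: less_induct)
    case less
    show ?case
    proof (cases "depth T y < depth T x")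
      case True
      then obtain z where z: "z \<in> h" "(x, z) \<in> edges T"
        using T(6)[OF assms(2,3) less.prems(1)] by blast
      then have "depth T x = Suc (depth T z)" by (simp add: depth_edge[OF T(2)])
      with less.hyps[of z] z True show ?thesis by (auto intro: converse_rtrancl_into_rtrancl)
    qed (use less.prems in auto)
  qed
  with that show thesis by blast
qed

text \<open>Conditions (ii) and (iii) survive the removal of an ancestor-closed set although depths change by
  different amounts: if the parent \<open>z\<close> of \<open>y\<close> is not in the hyperedge, then every node of the
  hyperedge lies below \<open>z\<close>, hence below a remaining node.\<close>

lemma lions_restrict_complement:
  assumes "T \<in> lions_forests" and R: "R \<in> ancestor_closed T" and "R \<noteq> nodes T"
  shows "lions_restrict T (nodes T - R) \<in> lions_forests"
proof -
  let ?A = "nodes T - R"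
  let ?S = "lions_restrict T ?A"
  note T = lions_forestsD[OF assms(1)]
  have sv: "single_valued (edges T)" and E: "edges T \<subseteq> nodes T \<times> nodes T"
    using T(2) by (simp_all add: directed_forest_iff)
  have ne: "?A \<noteq> {}" and cl: "\<And>x z. z \<in> ?A \<Longrightarrow> (x, z) \<in> edges T \<Longrightarrow> x \<in> ?A"
    using R assms(3) E by (auto simp: ancestor_closed_def)
  have S: "directed_forest ?S"
    using T(2) by (rule directed_forest_subset) auto
  \<comment> \<open>Every node below a remaining \<open>w\<close> remains, and its depth drops by
    the same amount as that of \<open>w\<close>. Sums replace differences because subtraction of
    natural numbers truncates.\<close>
  have down: "x \<in> ?A \<and> depth ?S x + depth T w = depth ?S w + depth T x"
    if "(x, w) \<in> (edges T)\<^sup>*" "w \<in> ?A" for x w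
    using that
  proof (induction rule: converse_rtrancl_induct)
    case (step x y)
    then have y: "y \<in> ?A" "depth ?S y + depth T w = depth ?S w + depth T y" by blast+
    then have x: "x \<in> ?A" using cl step.hyps(1) by blast
    with y step.hyps(1) have "(x, y) \<in> edges ?S" by simp
    then have "depth ?S x = Suc (depth ?S y)" by (rule depth_edge[OF S])
    with x y depth_edge[OF T(2) step.hyps(1)] show ?case by linarith
  qed simp
  have key: "depth ?S y \<le> depth ?S x \<and> (depth ?S x = depth ?S y \<longrightarrow> (x, z) \<in> edges T)"
    if h: "h \<in> insert (hyp0 T) (hyps T)" "x \<in> h" "y \<in> h" and yz: "(y, z) \<in> edges T" "z \<in> ?A" "z \<notin> h"
    for h x y z
  proof -
    have "\<not> depth T x < depth T y"
      using T(6)[OF h] yz sv by (auto dest: single_valuedD)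
    then obtain w where w: "w \<in> h" "(x, w) \<in> (edges T)\<^sup>*" "depth T w = depth T y"
      using hyperedge_climb[OF assms(1) h(1,3,2)] by auto
    \<comment> \<open>\<open>y\<close> has the parent \<open>z\<close>, so \<open>w\<close>, at the
      same depth, is no root either.\<close>
    have "1 < depth T w"
      using depth_edge[OF T(2) yz(1)] depth_pos[OF T(2), of z] w(3) by simp
    then obtain w' where w': "(w, w') \<in> edges T" using depth_gt_1_edge by blast
    \<comment> \<open>By (iii), distinct parents of \<open>y\<close> and \<open>w\<close> would both
      lie in \<open>h\<close>, but \<open>z\<close> does not.\<close>
    have "w' = z"
      using T(7)[OF h(1,3) w(1) w(3)[symmetric] yz(1) w'] yz(3) by blast
    with w' have wz: "(w, z) \<in> edges T" by simp
    have wA: "w \<in> ?A" and yA: "y \<in> ?A" using cl yz wz by blast+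
    have "depth ?S w = depth ?S y"
      using depth_edge[OF S, of w z] depth_edge[OF S, of y z] wz yz wA yA by auto
    moreover have "depth ?S x + depth T w = depth ?S w + depth T x"
      using down[OF w(2) wA] by simp
    moreover note depth_rtrancl[OF T(2) w(2)]
    ultimately show ?thesis using wz by auto
  qed
  show ?thesis
  proof (rule lions_forests_restrictI[OF assms(1) _ ne], goal_cases)
    case (2 h x y z)
    show ?case
    proof (rule ccontr)
      assume "z \<notin> h"
      with key[of h x y z] 2(1-4,6) have "depth ?S y \<le> depth ?S x" by simp
      with 2(5) show False by simp
    qed
  next
    case (3 h x1 y1 x2 y2)
    show ?case
    proof (rule ccontr)
      assume "x2 \<notin> h"
      \<comment> \<open>The equality case of \<open>key\<close>: equal depths in the restriction
        make \<open>x2\<close> the parent of \<open>y1\<close> as well, against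
        \<open>x2 \<noteq> y2\<close>.\<close>
      with key[of h y1 x1 x2] 3(1-4,6,7) have "(y1, x2) \<in> edges T" by simp
      with 3(8,9) sv show False by (meson single_valuedD)
    qed
  qed auto
qed

section \<open>Labelled forests and relabelling\<close>

lemma trunc_lions_forests0_empty [simp]: "empty_lions \<in> trunc_lions_forests0 \<gamma> \<alpha>"
  by (simp add: trunc_lions_forests0_def)

lemma trunc_lions_forests_subset: "trunc_lions_forests \<gamma> \<alpha> \<subseteq> trunc_lions_forests0 \<gamma> \<alpha>"
  by (auto simp: trunc_lions_forests0_def)

text \<open>The empty forest is included whatever \<open>\<gamma>\<close> is, hence the condition
  \<open>0 \<le> \<gamma>\<close> in front of the size bound.\<close>

lemma trunc_lions_forests0D:
  assumes "T \<in> trunc_lions_forests0 \<gamma> \<alpha>"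
  shows "directed_forest T" "finite (nodes T)" "hyp0 T \<subseteq> nodes T"
    "partition_on (nodes T - hyp0 T) (hyps T)" "finite (hyps T)"
    "0 \<le> \<gamma> \<Longrightarrow> \<alpha> * real (card (nodes T)) \<le> \<gamma>"
    "nodes T = {} \<longleftrightarrow> T = empty_lions"
proof -
  have *: "directed_forest T \<and> hyp0 T \<subseteq> nodes T \<and> partition_on (nodes T - hyp0 T) (hyps T) \<and>
    (0 \<le> \<gamma> \<longrightarrow> \<alpha> * real (card (nodes T)) \<le> \<gamma>) \<and> (nodes T = {} \<longleftrightarrow> T = empty_lions)"
  proof (cases "T = empty_lions")
    case True
    then show ?thesis by (simp add: directed_forest_iff partition_on_def acyclic_def)
  next
    case False
    with assms have "T \<in> lions_forests" "\<alpha> * real (card (nodes T)) \<le> \<gamma>"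
      by (simp_all add: trunc_lions_forests0_def trunc_lions_forests_def)
    with False lions_forestsD(1-4)[of T] show ?thesis by simp
  qed
  then show "directed_forest T" "finite (nodes T)" "hyp0 T \<subseteq> nodes T"
    "partition_on (nodes T - hyp0 T) (hyps T)"
    "0 \<le> \<gamma> \<Longrightarrow> \<alpha> * real (card (nodes T)) \<le> \<gamma>" "nodes T = {} \<longleftrightarrow> T = empty_lions"
    by (simp_all add: directed_forest_iff)
  then show "finite (hyps T)"
    by (meson finite_Diff finite_elements)
qed

lemma scaled_card_bound_mono:
  assumes "0 \<le> \<alpha>" and "A \<subseteq> B" and "finite B" and "\<alpha> * real (card B) \<le> \<gamma>"
  shows "\<alpha> * real (card A) \<le> \<gamma>"
  using mult_left_mono[OF of_nat_mono[OF card_mono[OF assms(3,2)]] assms(1)] assms(4) by linarith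

lemma lions_restrict_nodes:
  assumes "T \<in> trunc_lions_forests0 \<gamma> \<alpha>"
  shows "lions_restrict T (nodes T) = T"
proof -
  note T = trunc_lions_forests0D[OF assms]
  have "edges T \<inter> nodes T \<times> nodes T = edges T" "hyp0 T \<inter> nodes T = hyp0 T"
    using T(1,3) by (auto simp: directed_forest_iff)
  moreover have "h \<inter> nodes T = h" "h \<noteq> {}" if "h \<in> hyps T" for h
    using T(4) that by (auto simp: partition_on_def)
  then have "(\<lambda>h. h \<inter> nodes T) ` hyps T - {{}} = hyps T" by force
  ultimately show ?thesis by (simp add: lions_restrict_def)
qed

lemma lions_restrict_trunc:
  assumes "0 \<le> \<alpha>" and T: "T \<in> trunc_lions_forests0 \<gamma> \<alpha>" and R: "R \<in> ancestor_closed T"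
  shows "lions_restrict T R \<in> trunc_lions_forests0 \<gamma> \<alpha>"
    and "lions_restrict T (nodes T - R) \<in> trunc_lions_forests0 \<gamma> \<alpha>"
proof -
  have sub: "R \<subseteq> nodes T" using R by (simp add: ancestor_closed_def)
  show "lions_restrict T R \<in> trunc_lions_forests0 \<gamma> \<alpha>"
  proof (cases "R = {}")
    case False
    with sub have "T \<noteq> empty_lions" by auto
    with T have T': "T \<in> lions_forests" "\<alpha> * real (card (nodes T)) \<le> \<gamma>"
      by (simp_all add: trunc_lions_forests0_def trunc_lions_forests_def)
    have "lions_restrict T R \<in> lions_forests"
      using lions_restrict_closed[OF T'(1) R False] .
    moreover have "\<alpha> * real (card R) \<le> \<gamma>"
      using scaled_card_bound_mono[OF assms(1) sub _ T'(2)] trunc_lions_forests0D(2)[OF T] by simp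
    ultimately show ?thesis
      by (simp add: trunc_lions_forests0_def trunc_lions_forests_def)
  qed simp
  show "lions_restrict T (nodes T - R) \<in> trunc_lions_forests0 \<gamma> \<alpha>"
  proof (cases "R = nodes T")
    case False
    with sub have "T \<noteq> empty_lions" by auto
    with T have T': "T \<in> lions_forests" "\<alpha> * real (card (nodes T)) \<le> \<gamma>"
      by (simp_all add: trunc_lions_forests0_def trunc_lions_forests_def)
    have "lions_restrict T (nodes T - R) \<in> lions_forests"
      using lions_restrict_complement[OF T'(1) R False] .
    moreover have "\<alpha> * real (card (nodes T - R)) \<le> \<gamma>"
      using scaled_card_bound_mono[OF assms(1) Diff_subset _ T'(2)] trunc_lions_forests0D(2)[OF T] by simp
    ultimately show ?thesis
      by (simp add: trunc_lions_forests0_def trunc_lions_forests_def)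
  qed simp
qed

lemma finite_ancestor_closed: "finite (nodes F) \<Longrightarrow> finite (ancestor_closed F)"
  by (rule finite_subset[of _ "Pow (nodes F)"]) (auto simp: ancestor_closed_def)

lemma empty_ancestor_closed [simp]: "{} \<in> ancestor_closed F"
  by (simp add: ancestor_closed_def)

lemma nodes_ancestor_closed: "directed_forest F \<Longrightarrow> nodes F \<in> ancestor_closed F"
  by (auto simp: ancestor_closed_def directed_forest_iff)

section \<open>Unit, zero and identity transport for tensors\<close>

lemma multi_indices_extensional [simp]: "multi_indices A = extensional A"
  by (auto simp: PiE_def)

lemma tensor_prod_one_right:
  assumes "a \<in> tensor_space A"
  shows "tensor_prod A {} a tensor_one = a"
  using assms by (auto simp: tensor_prod_def tensor_one_def tensor_space_def fun_eq_iff extensional_restrict)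

lemma tensor_prod_one_left:
  assumes "a \<in> tensor_space A"
  shows "tensor_prod {} A tensor_one a = a"
  using assms by (auto simp: tensor_prod_def tensor_one_def tensor_space_def fun_eq_iff extensional_restrict)

lemma tensor_prod_zero [simp]:
  "tensor_prod A B (\<lambda>_. 0) b = (\<lambda>_. 0)" "tensor_prod A B a (\<lambda>_. 0) = (\<lambda>_. 0)"
  by (simp_all add: tensor_prod_def fun_eq_iff)

lemma tensor_map_ident:
  fixes a :: "'d tensor"
  assumes "a \<in> tensor_space A"
  shows "tensor_map (\<lambda>x. x) A a = a"
proof
  fix j :: "nat \<Rightarrow> 'd"
  have "(\<lambda>x\<in>A. j x) = j" if "j \<in> extensional A" using that by (rule extensional_restrict)
  with assms show "tensor_map (\<lambda>x. x) A a j = a j"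
    by (simp add: tensor_map_def tensor_space_def)
qed

section \<open>Labelled forests and branched characters\<close>

lemma labelled_restrict_simps [simp]:
  "nodes (labelled_restrict \<tau> A) = A"
  "edges (labelled_restrict \<tau> A) = edges \<tau> \<inter> A \<times> A"
  "label (labelled_restrict \<tau> A) = label \<tau>"
  by (simp_all add: labelled_restrict_def)

lemma labelled_restrict_nodes:
  assumes "directed_forest \<tau>"
  shows "labelled_restrict \<tau> (nodes \<tau>) = \<tau>"
proof -
  have "edges \<tau> \<inter> nodes \<tau> \<times> nodes \<tau> = edges \<tau>"
    using assms by (auto simp: directed_forest_iff)
  then show ?thesis by (simp add: labelled_restrict_def)
qed

lemma labelled_forests_restrict:
  assumes "0 \<le> \<alpha>" and "\<tau> \<in> labelled_forests N \<gamma> \<alpha>" and "A \<subseteq> nodes \<tau>"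
  shows "labelled_restrict \<tau> A \<in> labelled_forests N \<gamma> \<alpha>"
proof -
  have \<tau>: "directed_forest \<tau>" "\<forall>x\<in>nodes \<tau>. label \<tau> x \<in> {1..N}" "\<alpha> * real (card (nodes \<tau>)) \<le> \<gamma>"
    using assms(2) by (simp_all add: labelled_forests_def)
  have "directed_forest (labelled_restrict \<tau> A)"
    using \<tau>(1) by (rule directed_forest_subset) (use assms(3) in simp_all)
  moreover have "\<alpha> * real (card A) \<le> \<gamma>"
    using scaled_card_bound_mono[OF assms(1,3) _ \<tau>(3)] \<tau>(1) by (simp add: directed_forest_iff)
  ultimately show ?thesis
    using \<tau>(2) assms(3) by (auto simp: labelled_forests_def)
qed

lemma branched_charactersD:
  assumes "v \<in> branched_characters N \<gamma> \<alpha>"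
  shows "\<And>\<tau>. \<tau> \<in> labelled_forests N \<gamma> \<alpha> \<Longrightarrow> v \<tau> \<in> tensor_space (nodes \<tau>)"
    "\<And>\<tau> \<tau>' \<phi>. \<tau> \<in> labelled_forests N \<gamma> \<alpha> \<Longrightarrow> \<tau>' \<in> labelled_forests N \<gamma> \<alpha> \<Longrightarrow> labelled_iso \<phi> \<tau> \<tau>' \<Longrightarrow>
        v \<tau>' = tensor_map \<phi> (nodes \<tau>) (v \<tau>)"
    "\<And>\<tau>. \<tau> \<in> labelled_forests N \<gamma> \<alpha> \<Longrightarrow> nodes \<tau> = {} \<Longrightarrow> v \<tau> = tensor_one"
    "\<And>\<tau>1 \<tau>2. \<tau>1 \<in> labelled_forests N \<gamma> \<alpha> \<Longrightarrow> \<tau>2 \<in> labelled_forests N \<gamma> \<alpha> \<Longrightarrow>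
        nodes \<tau>1 \<inter> nodes \<tau>2 = {} \<Longrightarrow> labelled_union \<tau>1 \<tau>2 \<in> labelled_forests N \<gamma> \<alpha> \<Longrightarrow>
        v (labelled_union \<tau>1 \<tau>2) = tensor_prod (nodes \<tau>1) (nodes \<tau>2) (v \<tau>1) (v \<tau>2)"
  using assms unfolding branched_characters_def mem_Collect_eq by (elim conjE; simp)+

text \<open>The identity is an isomorphism between the two forests. Labels outside the nodes carry
  no meaning, yet they distinguish records; this lemma lets values of a character be compared when
  records agree on the nodes only.\<close>

lemma branched_character_cong:
  assumes "v \<in> branched_characters N \<gamma> \<alpha>"
    and "\<tau> \<in> labelled_forests N \<gamma> \<alpha>" and "\<tau>' \<in> labelled_forests N \<gamma> \<alpha>"
    and "nodes \<tau>' = nodes \<tau>" and "edges \<tau>' = edges \<tau>" and "\<And>x. x \<in> nodes \<tau> \<Longrightarrow> label \<tau>' x = label \<tau> x"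
  shows "v \<tau>' = v \<tau>"
proof -
  have "labelled_iso (\<lambda>x. x) \<tau> \<tau>'"
    using assms(4-) by (simp add: labelled_iso_def forest_iso_def bij_betw_def map_prod_def)
  from branched_charactersD(2)[OF assms(1-3) this] show ?thesis
    using tensor_map_ident[OF branched_charactersD(1)[OF assms(1,2)]] by simp
qed

text \<open>In \<open>v \<tau> = (v \<ast> v) \<tau>\<close> the extreme ancestor-closed sets contribute \<open>v \<tau>\<close> each; the other terms
  vanish by induction.\<close>

lemma idempotent_branched_character:
  assumes "0 \<le> \<alpha>" and v: "v \<in> branched_characters N \<gamma> \<alpha>"
    and idem: "\<And>\<tau>. \<tau> \<in> labelled_forests N \<gamma> \<alpha> \<Longrightarrow> v \<tau> = branched_conv v v \<tau>"
    and "\<tau> \<in> labelled_forests N \<gamma> \<alpha>"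
  shows "v \<tau> = branched_unit \<tau>"
  using assms(4)
proof (induction "card (nodes \<tau>)" arbitrary: \<tau> rule: less_induct)
  case less
  show ?case
  proof (cases "nodes \<tau> = {}")
    case True
    then show ?thesis using branched_charactersD(3)[OF v less.prems] by (simp add: branched_unit_def)
  next
    case False
    have \<tau>: "directed_forest \<tau>" "finite (nodes \<tau>)"
      using less.prems by (simp_all add: labelled_forests_def directed_forest_iff)
    let ?t = "\<lambda>R. tensor_prod (nodes \<tau> - R) R (v (labelled_restrict \<tau> (nodes \<tau> - R))) (v (labelled_restrict \<tau> R))"
    have zero: "?t R = (\<lambda>_. 0)" if "R \<in> ancestor_closed \<tau> - {{}, nodes \<tau>}" for R
    proof -
      have R: "R \<subset> nodes \<tau>" "R \<noteq> {}" using that by (auto simp: ancestor_closed_def)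
      then have "v (labelled_restrict \<tau> R) = branched_unit (labelled_restrict \<tau> R)"
        using less.hyps[of "labelled_restrict \<tau> R"] psubset_card_mono[OF \<tau>(2)]
          labelled_forests_restrict[OF assms(1) less.prems] by simp
      with R(2) show ?thesis by (simp add: branched_unit_def)
    qed
    have empty: "v (labelled_restrict \<tau> {}) = tensor_one"
      using branched_charactersD(3)[OF v labelled_forests_restrict[OF assms(1) less.prems]] by simp
    have self: "v (labelled_restrict \<tau> (nodes \<tau>)) = v \<tau>"
      using labelled_restrict_nodes[OF \<tau>(1)] by simp
    have v\<tau>: "v \<tau> \<in> tensor_space (nodes \<tau>)" using branched_charactersD(1)[OF v less.prems] .
    have "v \<tau> j = 0" for j
    proof -
      have "v \<tau> j = branched_conv v v \<tau> j" using idem[OF less.prems] by simp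
      also have "\<dots> = (\<Sum>R\<in>{{}, nodes \<tau>}. ?t R j)"
        unfolding branched_conv_def
        using finite_ancestor_closed[OF \<tau>(2)] nodes_ancestor_closed[OF \<tau>(1)] zero
        by (intro sum.mono_neutral_right) auto
      also have "\<dots> = v \<tau> j + v \<tau> j"
        using False empty self tensor_prod_one_right[OF v\<tau>] tensor_prod_one_left[OF v\<tau>] by simp
      finally show ?thesis by simp
    qed
    with False show ?thesis by (simp add: branched_unit_def fun_eq_iff)
  qed
qed

section \<open>Labels induced by hyperedges and restriction of variables\<close>

lemma the_block:
  assumes "partition_on A P" and "h \<in> P" and "x \<in> h"
  shows "(THE h. h \<in> P \<and> x \<in> h) = h"
  using assms by (intro the_equality) (auto simp: partition_on_def disjoint_def)

lemma ex_block: "partition_on A P \<Longrightarrow> x \<in> A \<Longrightarrow> \<exists>h\<in>P. x \<in> h"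
  by (auto simp: partition_on_def)

lemma relabel_simps [simp]:
  "nodes (relabel u i T \<omega>) = nodes T" "edges (relabel u i T \<omega>) = edges T"
  by (simp_all add: relabel_def)

lemma label_relabel_hyp0: "x \<in> hyp0 T \<Longrightarrow> label (relabel u i T \<omega>) x = i"
  by (simp add: relabel_def)

lemma label_relabel_hyps:
  assumes "partition_on (nodes T - hyp0 T) (hyps T)" and "h \<in> hyps T" and "x \<in> h"
  shows "label (relabel u i T \<omega>) x = u (\<omega> h)"
proof -
  have "x \<notin> hyp0 T" using assms by (auto simp: partition_on_def)
  then show ?thesis using the_block[OF assms] by (simp add: relabel_def)
qed

lemma node_cases:
  assumes "partition_on (nodes T - hyp0 T) (hyps T)" and "x \<in> nodes T"
  obtains "x \<in> hyp0 T" | h where "h \<in> hyps T" "x \<in> h" "x \<notin> hyp0 T"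
  using assms ex_block[OF assms(1), of x] by blast

lemma relabel_labelled_forests:
  assumes "directed_forest T" and "partition_on (nodes T - hyp0 T) (hyps T)"
    and "\<alpha> * real (card (nodes T)) \<le> \<gamma>"
    and "i \<in> {1..N}" and "\<And>h. h \<in> hyps T \<Longrightarrow> u (\<omega> h) \<in> {1..N}"
  shows "relabel u i T \<omega> \<in> labelled_forests N \<gamma> \<alpha>"
proof -
  have "label (relabel u i T \<omega>) x \<in> {1..N}" if "x \<in> nodes T" for x
    using assms(2) that
    by (rule node_cases) (use assms(4,5) label_relabel_hyp0 label_relabel_hyps[OF assms(2)] in metis)+
  moreover have "directed_forest (relabel u i T \<omega>)"
    using assms(1) by (simp add: directed_forest_iff)
  ultimately show ?thesis using assms(3) by (simp add: labelled_forests_def)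
qed

lemma the_hyperedge_Int:
  assumes "partition_on B P" and "h \<in> P" and "h \<inter> A \<noteq> {}"
  shows "(THE h'. h' \<in> P \<and> h' \<inter> A = h \<inter> A) = h"
  using assms by (intro the_equality) (auto simp: partition_on_def disjoint_def)

lemma pull_vars_Int:
  assumes "partition_on B (hyps T)" and "h \<in> hyps T" and "h \<inter> A \<noteq> {}"
  shows "pull_vars T A \<omega> (h \<inter> A) = \<omega> h"
  using assms the_hyperedge_Int[OF assms] by (simp add: pull_vars_def)

text \<open>The block of \<open>x\<close> in the restriction is the trace
  \<open>h \<inter> A\<close> of its old block, and \<open>pull_vars\<close> attaches
  \<open>\<omega> h\<close> to it, so the label is unchanged.\<close>

lemma label_relabel_restrict:
  assumes "partition_on (nodes T - hyp0 T) (hyps T)" and "A \<subseteq> nodes T" and "x \<in> A"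
  shows "label (relabel u i (lions_restrict T A) (pull_vars T A \<omega>)) x = label (relabel u i T \<omega>) x"
proof -
  have P: "partition_on (nodes (lions_restrict T A) - hyp0 (lions_restrict T A)) (hyps (lions_restrict T A))"
    using partition_on_lions_restrict[OF assms(1,2)] by simp
  have "x \<in> nodes T" using assms(2,3) by blast
  with assms(1) show ?thesis
  proof (rule node_cases)
    assume "x \<in> hyp0 T"
    with assms(3) show ?thesis by (simp add: label_relabel_hyp0)
  next
    fix h assume h: "h \<in> hyps T" "x \<in> h" "x \<notin> hyp0 T"
    have "h \<inter> A \<in> hyps (lions_restrict T A)" "x \<in> h \<inter> A" "h \<inter> A \<noteq> {}"
      using h assms(3) by auto
    then show ?thesis
      using label_relabel_hyps[OF P] label_relabel_hyps[OF assms(1) h(1,2)] pull_vars_Int[OF assms(1) h(1)] by metis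
  qed
qed

lemma pull_vars_nodes:
  assumes "T \<in> trunc_lions_forests0 \<gamma> \<alpha>" and "\<omega> \<in> extensional (hyps T)"
  shows "pull_vars T (nodes T) \<omega> = \<omega>"
proof -
  note T = trunc_lions_forests0D(4)[OF assms(1)]
  have "pull_vars T (nodes T) \<omega> h = \<omega> h" if "h \<in> hyps T" for h
  proof -
    have "h \<inter> nodes T = h" "h \<noteq> {}" using T that by (auto simp: partition_on_def)
    then show ?thesis using pull_vars_Int[OF T that, of "nodes T"] by simp
  qed
  \<comment> \<open>Outside the hyperedges both functions are \<open>undefined\<close>;
    extensionality makes this an equality of points of the product space.\<close>
  moreover have "pull_vars T (nodes T) \<omega> h = \<omega> h" if "h \<notin> hyps T" for h
    using that assms(2) unfolding pull_vars_def lions_restrict_nodes[OF assms(1)]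
    by (simp add: extensional_def)
  ultimately show ?thesis by blast
qed

section \<open>Almost everywhere statements and inverses\<close>

text \<open>A normal form for records that describe the same labelled forest. With nodes, edges and
  the range of labels fixed there are finitely many normal forms, although there are infinitely many
  records.\<close>

definition canonical_labelling :: "labelled_forest \<Rightarrow> labelled_forest" where
  "canonical_labelling \<tau> = \<lparr>nodes = nodes \<tau>, edges = edges \<tau>, label = restrict (label \<tau>) (nodes \<tau>)\<rparr>"

lemma canonical_labelling_in:
  "\<tau> \<in> labelled_forests N \<gamma> \<alpha> \<Longrightarrow> canonical_labelling \<tau> \<in> labelled_forests N \<gamma> \<alpha>"
  by (simp add: canonical_labelling_def labelled_forests_def directed_forest_iff)

lemma branched_character_canonical:
  assumes "v \<in> branched_characters N \<gamma> \<alpha>" and "\<tau> \<in> labelled_forests N \<gamma> \<alpha>"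
  shows "v (canonical_labelling \<tau>) = v \<tau>"
  using assms by (intro branched_character_cong[where N = N and \<gamma> = \<gamma> and \<alpha> = \<alpha>] canonical_labelling_in)
    (simp_all add: canonical_labelling_def)

text \<open>Only finitely many label functions on \<open>A\<close> matter, so bounds for single labelled forests become
  uniform in the labels.\<close>

lemma uniform_labelled_bound:
  fixes P :: "labelled_forest \<Rightarrow> real \<Rightarrow> bool"
  assumes "finite A"
    and "\<And>\<tau>. \<tau> \<in> labelled_forests N \<gamma> \<alpha> \<Longrightarrow> \<exists>C. P \<tau> C"
    and mono: "\<And>\<tau> C C'. P \<tau> C \<Longrightarrow> C \<le> C' \<Longrightarrow> P \<tau> C'"
    and can: "\<And>\<tau> C. \<tau> \<in> labelled_forests N \<gamma> \<alpha> \<Longrightarrow> P (canonical_labelling \<tau>) C \<Longrightarrow> P \<tau> C"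
  obtains C where "0 \<le> C"
    and "\<And>\<tau>. \<tau> \<in> labelled_forests N \<gamma> \<alpha> \<Longrightarrow> nodes \<tau> = A \<Longrightarrow> edges \<tau> = E \<Longrightarrow> P \<tau> C"
proof -
  let ?L = "canonical_labelling ` {\<tau> \<in> labelled_forests N \<gamma> \<alpha>. nodes \<tau> = A \<and> edges \<tau> = E}"
  have "?L \<subseteq> (\<lambda>l. \<lparr>nodes = A, edges = E, label = l\<rparr>) ` (A \<rightarrow>\<^sub>E {1..N})"
    by (auto simp: canonical_labelling_def labelled_forests_def intro!: imageI)
  then have fin: "finite ?L"
    by (rule finite_subset) (intro finite_imageI finite_PiE assms(1) finite_atLeastAtMost)
  obtain b where b: "\<And>\<tau>. \<tau> \<in> labelled_forests N \<gamma> \<alpha> \<Longrightarrow> P \<tau> (b \<tau>)"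
    using assms(2) by metis
  \<comment> \<open>The sum of absolute values dominates every single bound and is nonnegative, also
    when no such forest exists.\<close>
  let ?C = "\<Sum>\<tau>\<in>?L. \<bar>b \<tau>\<bar>"
  have "P \<tau> ?C" if "\<tau> \<in> labelled_forests N \<gamma> \<alpha>" "nodes \<tau> = A" "edges \<tau> = E" for \<tau>
  proof (rule can[OF that(1)], rule mono)
    show "P (canonical_labelling \<tau>) (b (canonical_labelling \<tau>))"
      using b canonical_labelling_in[OF that(1)] by blast
    have "\<bar>b (canonical_labelling \<tau>)\<bar> \<le> ?C"
      using fin that by (intro member_le_sum) auto
    then show "b (canonical_labelling \<tau>) \<le> ?C" by linarith
  qed
  then show thesis using that[of ?C] by (simp add: sum_nonneg)
qed

section \<open>Mixed norms of bounded functions\<close>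

lemma ennreal_root_power_le:
  assumes "x \<le> ennreal C" and "0 \<le> C" and "0 \<le> a"
  shows "ennreal_root_power x a \<le> ennreal (C powr a)"
proof -
  have "x < \<infinity>" using assms(1) by (simp add: le_less_trans)
  moreover have "enn2real x \<le> C" using assms(1,2) by (simp add: enn2real_leI)
  ultimately show ?thesis
    using assms(3) by (auto simp: ennreal_root_power_def intro!: ennreal_leI powr_mono2)
qed

text \<open>On a probability space a constant integrates to itself, and the outer root undoes the
  inner power, so each variable preserves the bound \<open>C\<close>. The bound on \<open>F\<close>
  is asked only where the listed coordinates lie in \<open>space M\<close>, because the base point
  of \<open>mixed_norm_finite\<close> is \<open>undefined\<close> everywhere.\<close>

lemma (in prob_space) iterated_norm_le:
  assumes "0 \<le> C" and "\<And>h. h \<in> set hs \<Longrightarrow> 0 < q h"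
    and "\<And>\<omega>'. (\<And>h. h \<notin> set hs \<Longrightarrow> \<omega>' h = \<omega> h) \<Longrightarrow> (\<And>h. h \<in> set hs \<Longrightarrow> \<omega>' h \<in> space M) \<Longrightarrow> F \<omega>' \<le> ennreal C"
  shows "iterated_norm M q hs F \<omega> \<le> ennreal C"
  using assms(2,3)
proof (induction hs arbitrary: \<omega>)
  case (Cons h hs)
  have q: "0 < q h" using Cons.prems(1) by simp
  have "iterated_norm M q hs F (fun_upd \<omega> h x) \<le> ennreal C" if "x \<in> space M" for x
  proof (rule Cons.IH)
    fix \<omega>' assume *: "\<And>h'. h' \<notin> set hs \<Longrightarrow> \<omega>' h' = (fun_upd \<omega> h x) h'" "\<And>h'. h' \<in> set hs \<Longrightarrow> \<omega>' h' \<in> space M"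
    show "F \<omega>' \<le> ennreal C"
    proof (rule Cons.prems(2))
      show "\<omega>' h' = \<omega> h'" if "h' \<notin> set (h # hs)" for h'
        using *(1)[of h'] that by simp
      show "\<omega>' h' \<in> space M" if "h' \<in> set (h # hs)" for h'
        using *(1)[of h'] *(2)[of h'] that \<open>x \<in> space M\<close> by (cases "h' \<in> set hs") auto
    qed
  qed (use Cons.prems(1) in simp)
  then have "(\<integral>\<^sup>+x. ennreal_root_power (iterated_norm M q hs F (fun_upd \<omega> h x)) (q h) \<partial>M)
      \<le> (\<integral>\<^sup>+x. ennreal (C powr q h) \<partial>M)"
    using q assms(1) by (intro nn_integral_mono ennreal_root_power_le) auto
  also have "\<dots> = ennreal (C powr q h)" by (simp add: emeasure_space_1)
  finally have "iterated_norm M q (h # hs) F \<omega> \<le> ennreal ((C powr q h) powr (1 / q h))"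
    using q unfolding iterated_norm.simps by (intro ennreal_root_power_le) auto
  also have "(C powr q h) powr (1 / q h) = C" using q assms(1) by (simp add: powr_powr)
  finally show ?case .
qed simp

section \<open>Null sets under restriction of variables\<close>

lemma pull_vars_reindex:
  assumes "partition_on B (hyps T)"
  defines "\<rho> \<equiv> \<lambda>A k. THE h. h \<in> hyps T \<and> h \<inter> A = k"
  shows "inj_on (\<rho> A) (hyps (lions_restrict T A))" and "\<rho> A \<in> hyps (lions_restrict T A) \<rightarrow> hyps T"
proof -
  \<comment> \<open>Intersecting with \<open>A\<close> recovers \<open>k\<close> from
    \<open>\<rho> A k\<close>. The resulting injectivity means that distinct variables of the
    restriction are distinct, hence independent, variables of \<open>T\<close>.\<close>
  have \<rho>: "\<rho> A k \<in> hyps T \<and> \<rho> A k \<inter> A = k" if k: "k \<in> hyps (lions_restrict T A)" for k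
  proof -
    obtain h where h: "h \<in> hyps T" "k = h \<inter> A" "h \<inter> A \<noteq> {}" using k by auto
    then have "\<rho> A k = h" using the_hyperedge_Int[OF assms(1) h(1,3)] by (simp add: \<rho>_def)
    with h show ?thesis by simp
  qed
  then show "inj_on (\<rho> A) (hyps (lions_restrict T A))" by (metis inj_onI)
  from \<rho> show "\<rho> A \<in> hyps (lions_restrict T A) \<rightarrow> hyps T" by blast
qed

text \<open>Passing from \<open>T\<close> to a restriction drops and renames variables, hence preserves the product measure.\<close>

lemma (in prob_space) AE_pull_vars:
  assumes "partition_on B (hyps T)"
    and "AE (\<omega>0, \<omega>) in M \<Otimes>\<^sub>M hyp_measure M (lions_restrict T A). P \<omega>0 \<omega>"
  shows "AE (\<omega>0, \<omega>) in M \<Otimes>\<^sub>M hyp_measure M T. P \<omega>0 (pull_vars T A \<omega>)"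
proof -
  let ?K = "hyps (lions_restrict T A)"
  let ?\<rho> = "\<lambda>k. THE h. h \<in> hyps T \<and> h \<inter> A = k"
  note \<rho> = pull_vars_reindex[OF assms(1), of A]
  have pull: "pull_vars T A = (\<lambda>\<omega>. \<lambda>k\<in>?K. \<omega> (?\<rho> k))"
    unfolding pull_vars_def ..
  have distr: "distr (hyp_measure M T) (PiM ?K (\<lambda>_. M)) (pull_vars T A) = PiM ?K (\<lambda>_. M)"
    unfolding pull by (rule distr_PiM_reindex[OF _ \<rho>]) (rule prob_space_axioms)
  have meas [measurable]: "pull_vars T A \<in> hyp_measure M T \<rightarrow>\<^sub>M PiM ?K (\<lambda>_. M)"
    unfolding pull using \<rho>(2) by (intro measurable_restrict measurable_component_singleton) auto
  interpret K: prob_space "PiM ?K (\<lambda>_. M)"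
    by (rule prob_space_PiM) (rule prob_space_axioms)
  \<comment> \<open>The variable \<open>\<omega>0\<close> is shared by all factors and stays fixed;
    writing \<open>M\<close> as its image under the identity gives the product the form required by
    \<open>pair_measure_distr\<close>.\<close>
  have "M \<Otimes>\<^sub>M PiM ?K (\<lambda>_. M) = distr M M (\<lambda>x. x) \<Otimes>\<^sub>M distr (hyp_measure M T) (PiM ?K (\<lambda>_. M)) (pull_vars T A)"
    by (simp only: distr distr_id)
  also have "\<dots> = distr (M \<Otimes>\<^sub>M hyp_measure M T) (M \<Otimes>\<^sub>M PiM ?K (\<lambda>_. M)) (\<lambda>(\<omega>0, \<omega>). (\<omega>0, pull_vars T A \<omega>))"
    by (rule pair_measure_distr) (use meas K.sigma_finite_measure_axioms distr in simp_all)
  finally have "AE x in distr (M \<Otimes>\<^sub>M hyp_measure M T) (M \<Otimes>\<^sub>M PiM ?K (\<lambda>_. M)) (\<lambda>(\<omega>0, \<omega>). (\<omega>0, pull_vars T A \<omega>)).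
      case x of (\<omega>0, \<omega>) \<Rightarrow> P \<omega>0 \<omega>"
    using assms(2) by (rule subst)
  then have "AE x in M \<Otimes>\<^sub>M hyp_measure M T.
      case (case x of (\<omega>0, \<omega>) \<Rightarrow> (\<omega>0, pull_vars T A \<omega>)) of (\<omega>0, \<omega>) \<Rightarrow> P \<omega>0 \<omega>"
    by (rule AE_distrD[rotated]) measurable
  then show ?thesis
    by (rule eventually_mono) (simp add: case_prod_unfold)
qed

section \<open>Congruence and cancellation for the convolution\<close>

lemma mv_charactersD:
  assumes "f \<in> mv_characters M \<gamma> \<alpha> q"
  shows "\<And>T \<omega>0 \<omega>. T \<in> trunc_lions_forests0 \<gamma> \<alpha> \<Longrightarrow> \<omega>0 \<in> space M \<Longrightarrow> \<omega> \<in> space (hyp_measure M T) \<Longrightarrow>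
      f T \<omega>0 \<omega> \<in> tensor_space (nodes T)"
    and "AE (\<omega>0, \<omega>) in M \<Otimes>\<^sub>M hyp_measure M empty_lions. f empty_lions \<omega>0 \<omega> = tensor_one"
  using assms unfolding mv_characters_def mem_Collect_eq by (elim conjE; simp)+

lemma (in prob_space) AE_mv_eq_pull:
  assumes "mv_eq M \<gamma> \<alpha> g g'" and "T \<in> trunc_lions_forests0 \<gamma> \<alpha>"
    and "lions_restrict T A \<in> trunc_lions_forests0 \<gamma> \<alpha>"
  shows "AE (\<omega>0, \<omega>) in M \<Otimes>\<^sub>M hyp_measure M T.
    g (lions_restrict T A) \<omega>0 (pull_vars T A \<omega>) = g' (lions_restrict T A) \<omega>0 (pull_vars T A \<omega>)"
proof (rule AE_pull_vars)
  show "AE (\<omega>0, \<omega>) in M \<Otimes>\<^sub>M hyp_measure M (lions_restrict T A).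
      g (lions_restrict T A) \<omega>0 \<omega> = g' (lions_restrict T A) \<omega>0 \<omega>"
    using assms(1,3) unfolding mv_eq_def by blast
qed (rule trunc_lions_forests0D(4)[OF assms(2)])

text \<open>The left factor enters through restrictions to complements. Each of the finitely many
  terms changes on a null set only, and a finite union of null sets is null.\<close>

lemma (in prob_space) mv_conv_cong_left:
  assumes "0 \<le> \<alpha>" and "mv_eq M \<gamma> \<alpha> g g'"
  shows "mv_eq M \<gamma> \<alpha> (mv_conv g f) (mv_conv g' f)"
  unfolding mv_eq_def
proof
  fix T assume T: "T \<in> trunc_lions_forests0 \<gamma> \<alpha>"
  have "AE x in M \<Otimes>\<^sub>M hyp_measure M T. \<forall>R\<in>ancestor_closed T.
      g (lions_restrict T (nodes T - R)) (fst x) (pull_vars T (nodes T - R) (snd x)) =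
      g' (lions_restrict T (nodes T - R)) (fst x) (pull_vars T (nodes T - R) (snd x))"
    using finite_ancestor_closed[OF trunc_lions_forests0D(2)[OF T]]
      AE_mv_eq_pull[OF assms(2) T lions_restrict_trunc(2)[OF assms(1) T]]
    by (intro AE_finite_allI) (auto simp: case_prod_unfold)
  then show "AE (\<omega>0, \<omega>) in M \<Otimes>\<^sub>M hyp_measure M T. mv_conv g f T \<omega>0 \<omega> = mv_conv g' f T \<omega>0 \<omega>"
    by eventually_elim (simp add: case_prod_unfold mv_conv_def)
qed

text \<open>The term \<open>R = nodes T\<close> is the right factor at \<open>T\<close> itself,
  since \<open>f\<close> is one on the empty forest; all other terms involve the right factor on
  fewer nodes, where both choices agree by induction and \<open>AE_pull_vars\<close>.\<close>

lemma (in prob_space) mv_conv_left_cancel: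
  assumes "0 \<le> \<alpha>" and f: "f \<in> mv_characters M \<gamma> \<alpha> q" and g: "g \<in> mv_characters M \<gamma> \<alpha> q"
    and g': "g' \<in> mv_characters M \<gamma> \<alpha> q" and eq: "mv_eq M \<gamma> \<alpha> (mv_conv f g) (mv_conv f g')"
  shows "mv_eq M \<gamma> \<alpha> g g'"
proof -
  have "AE (\<omega>0, \<omega>) in M \<Otimes>\<^sub>M hyp_measure M T. g T \<omega>0 \<omega> = g' T \<omega>0 \<omega>"
    if "T \<in> trunc_lions_forests0 \<gamma> \<alpha>" for T
    using that
  proof (induction "card (nodes T)" arbitrary: T rule: less_induct)
    case less
    note T = trunc_lions_forests0D[OF less.prems]
    let ?A = "ancestor_closed T - {nodes T}"
    have fin: "finite (ancestor_closed T)" using finite_ancestor_closed[OF T(2)] .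
    have "AE (\<omega>0, \<omega>) in M \<Otimes>\<^sub>M hyp_measure M T.
        g (lions_restrict T R) \<omega>0 (pull_vars T R \<omega>) = g' (lions_restrict T R) \<omega>0 (pull_vars T R \<omega>)"
      if "R \<in> ?A" for R
    proof (rule AE_pull_vars[OF T(4)], rule less.hyps)
      show "card (nodes (lions_restrict T R)) < card (nodes T)"
        using that T(2) by (auto simp: ancestor_closed_def intro!: psubset_card_mono)
      show "lions_restrict T R \<in> trunc_lions_forests0 \<gamma> \<alpha>"
        using that by (intro lions_restrict_trunc(1)[OF assms(1) less.prems]) simp
    qed
    then have "AE x in M \<Otimes>\<^sub>M hyp_measure M T. \<forall>R\<in>?A.
        g (lions_restrict T R) (fst x) (pull_vars T R (snd x)) = g' (lions_restrict T R) (fst x) (pull_vars T R (snd x))"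
      using fin by (intro AE_finite_allI) (auto simp: case_prod_unfold)
    \<comment> \<open>Normalisation at the empty forest is itself an almost sure statement and has
      to be transported to the variables of \<open>T\<close>.\<close>
    moreover have "AE (\<omega>0, \<omega>) in M \<Otimes>\<^sub>M hyp_measure M T. f (lions_restrict T {}) \<omega>0 (pull_vars T {} \<omega>) = tensor_one"
      using mv_charactersD(2)[OF f] by (intro AE_pull_vars[OF T(4)]) (simp only: lions_restrict_empty)
    then have "AE x in M \<Otimes>\<^sub>M hyp_measure M T. f empty_lions (fst x) (pull_vars T {} (snd x)) = tensor_one"
      by (simp add: case_prod_unfold)
    moreover have "AE x in M \<Otimes>\<^sub>M hyp_measure M T. mv_conv f g T (fst x) (snd x) = mv_conv f g' T (fst x) (snd x)"
      using eq less.prems by (simp add: mv_eq_def case_prod_unfold)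
    \<comment> \<open>At points of the space, values of characters lie in the tensor space and
      \<open>\<omega>\<close> is extensional; both are needed to evaluate the top term.\<close>
    moreover note AE_space
    ultimately have "AE x in M \<Otimes>\<^sub>M hyp_measure M T. g T (fst x) (snd x) = g' T (fst x) (snd x)"
    proof eventually_elim
      case (elim x)
      obtain \<omega>0 \<omega> where x: "x = (\<omega>0, \<omega>)" by (cases x)
      have sp: "\<omega>0 \<in> space M" "\<omega> \<in> space (hyp_measure M T)"
        using elim(4) by (simp_all add: x space_pair_measure)
      then have ext: "\<omega> \<in> extensional (hyps T)" by (simp add: space_PiM PiE_def)
      let ?t = "\<lambda>g R. tensor_prod (nodes T - R) R
         (f (lions_restrict T (nodes T - R)) \<omega>0 (pull_vars T (nodes T - R) \<omega>))
         (g (lions_restrict T R) \<omega>0 (pull_vars T R \<omega>))"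
      have top: "?t k (nodes T) = k T \<omega>0 \<omega>" if "k \<in> mv_characters M \<gamma> \<alpha> q" for k
        using elim(2) tensor_prod_one_left[OF mv_charactersD(1)[OF that less.prems sp]]
        by (simp add: x pull_vars_nodes[OF less.prems ext] lions_restrict_nodes[OF less.prems])
      have conv: "mv_conv f k T \<omega>0 \<omega> j = k T \<omega>0 \<omega> j + (\<Sum>R\<in>?A. ?t k R j)"
        if "k \<in> mv_characters M \<gamma> \<alpha> q" for k j
        unfolding mv_conv_def top[OF that, symmetric]
        by (rule sum.remove[OF fin nodes_ancestor_closed[OF T(1)]])
      have "(\<Sum>R\<in>?A. ?t g R j) = (\<Sum>R\<in>?A. ?t g' R j)" for j
        using elim(1) by (intro sum.cong) (simp_all add: x)
      with elim(3) conv[OF g] conv[OF g'] have "g T \<omega>0 \<omega> j = g' T \<omega>0 \<omega> j" for j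
        by (simp add: x fun_eq_iff)
      then show ?case by (simp add: x fun_eq_iff)
    qed
    then show ?case by (simp add: case_prod_unfold)
  qed
  then show ?thesis by (simp add: mv_eq_def)
qed

section \<open>The family of the particle system\<close>

text \<open>Measurability into \<open>count_space {1..N}\<close> also confines the labels to
  \<open>{1..N}\<close> on \<open>space M\<close>, and \<open>0 \<le> \<gamma>\<close> makes the
  empty forest obey the size bound.\<close>

locale particle_space = prob_space M for M :: "'w measure" +
  fixes u :: "'w \<Rightarrow> nat" and N :: nat and \<gamma> \<alpha> :: real
  assumes \<alpha>_nonneg: "0 \<le> \<alpha>" and \<gamma>_nonneg: "0 \<le> \<gamma>"
    and u_measurable [measurable]: "u \<in> M \<rightarrow>\<^sub>M count_space {1..N}"
begin

lemma u_in: "x \<in> space M \<Longrightarrow> u x \<in> {1..N}"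
  using measurable_space[OF u_measurable] by simp

lemma relabel_in:
  assumes "T \<in> trunc_lions_forests0 \<gamma> \<alpha>" and "\<omega>0 \<in> space M" and "\<And>h. h \<in> hyps T \<Longrightarrow> \<omega> h \<in> space M"
  shows "relabel u (u \<omega>0) T \<omega> \<in> labelled_forests N \<gamma> \<alpha>"
  using trunc_lions_forests0D[OF assms(1)] \<gamma>_nonneg assms(2,3) u_in
  by (intro relabel_labelled_forests) simp_all

lemma relabel_in_space:
  assumes "T \<in> trunc_lions_forests0 \<gamma> \<alpha>" and "\<omega>0 \<in> space M" and "\<omega> \<in> space (hyp_measure M T)"
  shows "relabel u (u \<omega>0) T \<omega> \<in> labelled_forests N \<gamma> \<alpha>"
  using assms by (intro relabel_in) (auto simp: space_PiM PiE_mem)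

lemma random_particle_family_eq: "random_particle_family u v T \<omega>0 \<omega> = v (relabel u (u \<omega>0) T \<omega>)"
  by (simp add: random_particle_family_def particle_family_def)

lemma AE_hyp_measureI:
  assumes "\<And>\<omega>0 \<omega>. \<omega>0 \<in> space M \<Longrightarrow> \<omega> \<in> space (hyp_measure M T) \<Longrightarrow> P \<omega>0 \<omega>"
  shows "AE (\<omega>0, \<omega>) in M \<Otimes>\<^sub>M hyp_measure M T. P \<omega>0 \<omega>"
  using assms by (intro AE_I2) (auto simp: space_pair_measure)

text \<open>Measurability holds because the labels of the nodes take values in a finite set.\<close>

lemma random_particle_family_measurable:
  assumes v: "v \<in> branched_characters N \<gamma> \<alpha>" and T: "T \<in> trunc_lions_forests0 \<gamma> \<alpha>"
  shows "(\<lambda>(\<omega>0, \<omega>). random_particle_family u v T \<omega>0 \<omega> j) \<in> borel_measurable (M \<Otimes>\<^sub>M hyp_measure M T)"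
proof -
  note T' = trunc_lions_forests0D[OF T]
  let ?l = "\<lambda>(\<omega>0, \<omega>). \<lambda>x\<in>nodes T. label (relabel u (u \<omega>0) T \<omega>) x"
  have "(\<lambda>(\<omega>0, \<omega>). label (relabel u (u \<omega>0) T \<omega>) x) \<in> M \<Otimes>\<^sub>M hyp_measure M T \<rightarrow>\<^sub>M count_space {1..N}"
    if "x \<in> nodes T" for x
    using T'(4) that
  proof (rule node_cases)
    assume x: "x \<in> hyp0 T"
    show ?thesis unfolding label_relabel_hyp0[OF x] by measurable
  next
    fix h assume h: "h \<in> hyps T" "x \<in> h"
    have [measurable]: "(\<lambda>\<omega>. \<omega> h) \<in> hyp_measure M T \<rightarrow>\<^sub>M M"
      using h(1) by (rule measurable_component_singleton)
    show ?thesis unfolding label_relabel_hyps[OF T'(4) h] by measurable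
  qed
  then have "?l \<in> M \<Otimes>\<^sub>M hyp_measure M T \<rightarrow>\<^sub>M PiM (nodes T) (\<lambda>_. count_space {1..N})"
    unfolding case_prod_unfold by (intro measurable_restrict)
  \<comment> \<open>A finite product of discrete finite spaces is discrete, so every function of the
    labels is measurable, in particular a coordinate of \<open>v\<close>.\<close>
  then have "?l \<in> M \<Otimes>\<^sub>M hyp_measure M T \<rightarrow>\<^sub>M count_space (nodes T \<rightarrow>\<^sub>E {1..N})"
    using count_space_PiM_finite[OF T'(2), of "\<lambda>_. {1..N}"] by simp
  then have "(\<lambda>x. v \<lparr>nodes = nodes T, edges = edges T, label = ?l x\<rparr> j) \<in> borel_measurable (M \<Otimes>\<^sub>M hyp_measure M T)"
    by (rule measurable_compose[where g = "\<lambda>l. v \<lparr>nodes = nodes T, edges = edges T, label = l\<rparr> j"]) simp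
  \<comment> \<open>The labels were cut off outside the nodes; passing to the canonical labelling
    does not change the value of \<open>v\<close>.\<close>
  moreover have "v \<lparr>nodes = nodes T, edges = edges T, label = ?l (\<omega>0, \<omega>)\<rparr> j = random_particle_family u v T \<omega>0 \<omega> j"
    if "\<omega>0 \<in> space M" "\<omega> \<in> space (hyp_measure M T)" for \<omega>0 \<omega>
    using branched_character_canonical[OF v relabel_in_space[OF T that]]
    by (simp add: canonical_labelling_def random_particle_family_eq restrict_def)
  ultimately show ?thesis
    by (subst measurable_cong[where g = "\<lambda>x. v \<lparr>nodes = nodes T, edges = edges T, label = ?l x\<rparr> j"])
      (auto simp: space_pair_measure)
qed

lemma random_particle_family_bounded:
  assumes v: "v \<in> branched_characters N \<gamma> \<alpha>" and T: "T \<in> trunc_lions_forests0 \<gamma> \<alpha>"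
  obtains C where "0 \<le> C"
    and "\<And>\<omega>0 \<omega>. \<omega>0 \<in> space M \<Longrightarrow> (\<And>h. h \<in> hyps T \<Longrightarrow> \<omega> h \<in> space M) \<Longrightarrow>
      tensor_norm (nodes T) (random_particle_family u v T \<omega>0 \<omega>) \<le> C"
proof (rule uniform_labelled_bound[where A = "nodes T" and N = N and \<gamma> = \<gamma> and \<alpha> = \<alpha> and E = "edges T" and
      P = "\<lambda>\<tau> C. tensor_norm (nodes T) (v \<tau>) \<le> C"])
  fix C :: real assume C: "0 \<le> C"
    "\<And>\<tau>. \<tau> \<in> labelled_forests N \<gamma> \<alpha> \<Longrightarrow> nodes \<tau> = nodes T \<Longrightarrow> edges \<tau> = edges T \<Longrightarrow>
      tensor_norm (nodes T) (v \<tau>) \<le> C"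
  show thesis
  proof (rule that[OF C(1)])
    fix \<omega>0 and \<omega> :: "nat set \<Rightarrow> 'w"
    assume "\<omega>0 \<in> space M" "\<And>h. h \<in> hyps T \<Longrightarrow> \<omega> h \<in> space M"
    then show "tensor_norm (nodes T) (random_particle_family u v T \<omega>0 \<omega>) \<le> C"
      unfolding random_particle_family_eq by (intro C(2) relabel_in[OF T]) simp_all
  qed
qed (use trunc_lions_forests0D(2)[OF T] branched_character_canonical[OF v] in auto)

section \<open>Isomorphisms, products and decoupling\<close>

lemma random_particle_family_iso:
  assumes v: "v \<in> branched_characters N \<gamma> \<alpha>"
    and T: "T \<in> trunc_lions_forests0 \<gamma> \<alpha>" and T': "T' \<in> trunc_lions_forests0 \<gamma> \<alpha>" and iso: "lions_iso \<phi> T T'"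
    and \<omega>0: "\<omega>0 \<in> space M" and \<omega>: "\<omega> \<in> space (hyp_measure M T')"
  shows "random_particle_family u v T' \<omega>0 \<omega> =
    tensor_map \<phi> (nodes T) (random_particle_family u v T \<omega>0 (\<lambda>h\<in>hyps T. \<omega> (\<phi> ` h)))"
proof -
  let ?\<omega> = "\<lambda>h\<in>hyps T. \<omega> (\<phi> ` h)"
  note P = trunc_lions_forests0D(4)[OF T] and P' = trunc_lions_forests0D(4)[OF T']
  have hyps: "hyps T' = (`) \<phi> ` hyps T" and hyp0: "hyp0 T' = \<phi> ` hyp0 T" and fi: "forest_iso \<phi> T T'"
    using iso by (simp_all add: lions_iso_def)
  have lab: "label (relabel u i T' \<omega>) (\<phi> x) = label (relabel u i T ?\<omega>) x" if "x \<in> nodes T" for x i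
    using P that
  proof (rule node_cases)
    assume "x \<in> hyp0 T"
    then show ?thesis using hyp0 by (simp add: label_relabel_hyp0)
  next
    fix h assume h: "h \<in> hyps T" "x \<in> h"
    then have "\<phi> ` h \<in> hyps T'" "\<phi> x \<in> \<phi> ` h" using hyps by auto
    then show ?thesis using label_relabel_hyps[OF P h, where u = u] label_relabel_hyps[OF P', where u = u] h(1) by simp
  qed
  have "labelled_iso \<phi> (relabel u (u \<omega>0) T ?\<omega>) (relabel u (u \<omega>0) T' \<omega>)"
    using fi lab by (simp add: labelled_iso_def forest_iso_def)
  moreover have "relabel u (u \<omega>0) T ?\<omega> \<in> labelled_forests N \<gamma> \<alpha>"
    using \<omega> hyps by (intro relabel_in[OF T \<omega>0]) (auto simp: space_PiM PiE_mem)
  ultimately show ?thesis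
    using branched_charactersD(2)[OF v _ relabel_in_space[OF T' \<omega>0 \<omega>]]
    by (simp add: random_particle_family_eq)
qed

text \<open>The relabelled product and the union of the relabelled factors need agree on nodes only.
  Multiplicativity of \<open>v\<close> applies to the union, and
  \<open>branched_character_cong\<close> carries the result to the product.\<close>

lemma random_particle_family_prod:
  assumes v: "v \<in> branched_characters N \<gamma> \<alpha>"
    and T1: "T1 \<in> trunc_lions_forests0 \<gamma> \<alpha>" and T2: "T2 \<in> trunc_lions_forests0 \<gamma> \<alpha>"
    and disj: "nodes T1 \<inter> nodes T2 = {}" and T: "lions_prod T1 T2 \<in> trunc_lions_forests0 \<gamma> \<alpha>"
    and \<omega>0: "\<omega>0 \<in> space M" and \<omega>: "\<omega> \<in> space (hyp_measure M (lions_prod T1 T2))"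
  shows "random_particle_family u v (lions_prod T1 T2) \<omega>0 \<omega> = tensor_prod (nodes T1) (nodes T2)
    (random_particle_family u v T1 \<omega>0 (restrict \<omega> (hyps T1)))
    (random_particle_family u v T2 \<omega>0 (restrict \<omega> (hyps T2)))"
proof -
  let ?\<tau> = "relabel u (u \<omega>0) (lions_prod T1 T2) \<omega>"
  let ?\<tau>1 = "relabel u (u \<omega>0) T1 (restrict \<omega> (hyps T1))"
  let ?\<tau>2 = "relabel u (u \<omega>0) T2 (restrict \<omega> (hyps T2))"
  have prod: "nodes (lions_prod T1 T2) = nodes T1 \<union> nodes T2" "edges (lions_prod T1 T2) = edges T1 \<union> edges T2"
    "hyp0 (lions_prod T1 T2) = hyp0 T1 \<union> hyp0 T2" "hyps (lions_prod T1 T2) = hyps T1 \<union> hyps T2"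
    by (simp_all add: lions_prod_def)
  note P1 = trunc_lions_forests0D(4)[OF T1] and P2 = trunc_lions_forests0D(4)[OF T2]
    and P = trunc_lions_forests0D(4)[OF T]
  have sp: "\<omega> h \<in> space M" if "h \<in> hyps T1 \<union> hyps T2" for h
    using \<omega> that prod(4) by (auto simp: space_PiM PiE_mem)
  have lf: "?\<tau> \<in> labelled_forests N \<gamma> \<alpha>" "?\<tau>1 \<in> labelled_forests N \<gamma> \<alpha>" "?\<tau>2 \<in> labelled_forests N \<gamma> \<alpha>"
    using relabel_in_space[OF T \<omega>0 \<omega>] relabel_in[OF T1 \<omega>0] relabel_in[OF T2 \<omega>0] sp by simp_all
  have lab: "label ?\<tau> x = label (relabel u (u \<omega>0) S (restrict \<omega> (hyps S))) x"
    if "S \<in> {T1, T2}" "x \<in> nodes S" for S x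
  proof -
    have PS: "partition_on (nodes S - hyp0 S) (hyps S)" using that(1) P1 P2 by auto
    from this that(2) show ?thesis
    proof (rule node_cases)
      assume "x \<in> hyp0 S"
      with that(1) prod(3) show ?thesis by (auto simp: label_relabel_hyp0)
    next
      fix h assume h: "h \<in> hyps S" "x \<in> h"
      with that(1) prod(4) have "h \<in> hyps (lions_prod T1 T2)" by auto
      from label_relabel_hyps[OF P this h(2), where u = u] label_relabel_hyps[OF PS h, where u = u] h(1) show ?thesis by simp
    qed
  qed
  have union: "nodes (labelled_union ?\<tau>1 ?\<tau>2) = nodes ?\<tau>" "edges (labelled_union ?\<tau>1 ?\<tau>2) = edges ?\<tau>"
    by (simp_all add: labelled_union_def prod)
  have labu: "label (labelled_union ?\<tau>1 ?\<tau>2) x = label ?\<tau> x" if "x \<in> nodes ?\<tau>" for x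
    using that lab[of T1 x] lab[of T2 x] by (auto simp: labelled_union_def prod)
  have lfu: "labelled_union ?\<tau>1 ?\<tau>2 \<in> labelled_forests N \<gamma> \<alpha>"
    using lf(1) union labu by (simp add: labelled_forests_def directed_forest_iff)
  have "v (labelled_union ?\<tau>1 ?\<tau>2) = v ?\<tau>"
    by (rule branched_character_cong[OF v lf(1) lfu union labu])
  moreover have "v (labelled_union ?\<tau>1 ?\<tau>2) = tensor_prod (nodes T1) (nodes T2) (v ?\<tau>1) (v ?\<tau>2)"
    using branched_charactersD(4)[OF v lf(2,3) _ lfu] disj by simp
  ultimately show ?thesis by (simp add: random_particle_family_eq)
qed

text \<open>On both sides the nodes of \<open>hyp0 T\<close> get the label
  \<open>u (\<omega> (hyp0 T))\<close>: on the left because this variable is inserted for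
  \<open>\<omega>0\<close>, on the right because \<open>hyp0 T\<close> has become an ordinary
  hyperedge. No node of \<open>decouple T\<close> sees \<open>\<omega>0\<close>.\<close>

lemma random_particle_family_decouple:
  assumes v: "v \<in> branched_characters N \<gamma> \<alpha>"
    and T: "T \<in> trunc_lions_forests0 \<gamma> \<alpha>" and ne: "hyp0 T \<noteq> {}"
    and \<omega>0: "\<omega>0 \<in> space M" and \<omega>: "\<omega> \<in> space (hyp_measure M (decouple T))"
  shows "random_particle_family u v T (\<omega> (hyp0 T)) (restrict \<omega> (hyps T)) = random_particle_family u v (decouple T) \<omega>0 \<omega>"
proof -
  let ?\<tau> = "relabel u (u (\<omega> (hyp0 T))) T (restrict \<omega> (hyps T))" and ?\<tau>' = "relabel u (u \<omega>0) (decouple T) \<omega>"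
  note T' = trunc_lions_forests0D[OF T]
  have ne_hyps: "h \<noteq> {}" if "h \<in> hyps T" for h using T'(4) that by (auto simp: partition_on_def)
  then have dec: "nodes (decouple T) = nodes T" "edges (decouple T) = edges T" "hyp0 (decouple T) = {}"
    "hyps (decouple T) = insert (hyp0 T) (hyps T)"
    using ne by (auto simp: decouple_def)
  have P: "partition_on (nodes (decouple T) - hyp0 (decouple T)) (hyps (decouple T))"
    using T'(3,4) ne unfolding dec by (auto simp: partition_on_def disjoint_def)
  have sp: "\<omega> h \<in> space M" if "h \<in> insert (hyp0 T) (hyps T)" for h
    using \<omega> that dec(4) by (auto simp: space_PiM PiE_mem)
  have lf: "?\<tau> \<in> labelled_forests N \<gamma> \<alpha>"
    using sp by (intro relabel_in[OF T]) simp_all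
  have lab: "label ?\<tau>' x = label ?\<tau> x" if "x \<in> nodes ?\<tau>" for x
  proof -
    have "x \<in> nodes T" using that by simp
    with T'(4) show ?thesis
    proof (rule node_cases)
      assume x: "x \<in> hyp0 T"
      then show ?thesis using label_relabel_hyps[OF P _ x, where u = u] by (simp add: dec label_relabel_hyp0)
    next
      fix h assume h: "h \<in> hyps T" "x \<in> h"
      then show ?thesis using label_relabel_hyps[OF P _ h(2), where u = u] label_relabel_hyps[OF T'(4) h, where u = u] by (simp add: dec)
    qed
  qed
  have lf': "?\<tau>' \<in> labelled_forests N \<gamma> \<alpha>"
    using lf lab by (simp add: labelled_forests_def directed_forest_iff dec)
  show ?thesis
    using branched_character_cong[OF v lf lf' _ _ lab] by (simp add: random_particle_family_eq dec)
qed

text \<open>The functions are bounded, so their mixed norms are finite for every order of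
  integration and any positive exponents; the algebraic clauses hold at every point.\<close>

lemma random_particle_family_in:
  assumes v: "v \<in> branched_characters N \<gamma> \<alpha>"
    and q: "\<And>T h. T \<in> trunc_lions_forests \<gamma> \<alpha> \<Longrightarrow> h \<in> hyps T \<Longrightarrow> 0 < q T h"
  shows "random_particle_family u v \<in> mv_characters M \<gamma> \<alpha> q"
  unfolding mv_characters_def mem_Collect_eq
proof (intro conjI ballI allI impI)
  fix T assume T: "T \<in> trunc_lions_forests0 \<gamma> \<alpha>"
  show "random_particle_family u v T \<omega>0 \<omega> \<in> tensor_space (nodes T)"
    if "\<omega>0 \<in> space M" "\<omega> \<in> space (hyp_measure M T)" for \<omega>0 \<omega>
    using branched_charactersD(1)[OF v relabel_in_space[OF T that]] by (simp add: random_particle_family_eq)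
  show "(\<lambda>(\<omega>0, \<omega>). random_particle_family u v T \<omega>0 \<omega> j) \<in> borel_measurable (M \<Otimes>\<^sub>M hyp_measure M T)" for j
    by (rule random_particle_family_measurable[OF v T])
  have q': "0 < q T h" if "h \<in> hyps T" for h
    using that T q by (cases "T = empty_lions") (auto simp: trunc_lions_forests0_def)
  obtain C where C: "0 \<le> C" "\<And>\<omega>0 \<omega>. \<omega>0 \<in> space M \<Longrightarrow> (\<And>h. h \<in> hyps T \<Longrightarrow> \<omega> h \<in> space M) \<Longrightarrow>
      tensor_norm (nodes T) (random_particle_family u v T \<omega>0 \<omega>) \<le> C"
    using random_particle_family_bounded[OF v T] by blast
  show "AE \<omega>0 in M. mixed_norm_finite M (q T) (hyps T)
      (\<lambda>\<omega>. ennreal (tensor_norm (nodes T) (random_particle_family u v T \<omega>0 \<omega>)))"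
  proof (rule AE_I2)
    fix \<omega>0 assume "\<omega>0 \<in> space M"
    have "iterated_norm M (q T) hs (\<lambda>\<omega>. ennreal (tensor_norm (nodes T) (random_particle_family u v T \<omega>0 \<omega>)))
        (\<lambda>_. undefined) < \<infinity>" if "set hs = hyps T" for hs
    proof (rule le_less_trans)
      show "iterated_norm M (q T) hs (\<lambda>\<omega>. ennreal (tensor_norm (nodes T) (random_particle_family u v T \<omega>0 \<omega>)))
          (\<lambda>_. undefined) \<le> ennreal C"
        using \<open>\<omega>0 \<in> space M\<close> that C q' by (intro iterated_norm_le ennreal_leI) simp_all
    qed simp
    then show "mixed_norm_finite M (q T) (hyps T)
        (\<lambda>\<omega>. ennreal (tensor_norm (nodes T) (random_particle_family u v T \<omega>0 \<omega>)))"
      by (simp add: mixed_norm_finite_def)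
  qed
next
  fix T T' \<phi> assume "T \<in> trunc_lions_forests0 \<gamma> \<alpha>" "T' \<in> trunc_lions_forests0 \<gamma> \<alpha>" "lions_iso \<phi> T T'"
  from random_particle_family_iso[OF v this]
  show "AE (\<omega>0, \<omega>) in M \<Otimes>\<^sub>M hyp_measure M T'. random_particle_family u v T' \<omega>0 \<omega> =
      tensor_map \<phi> (nodes T) (random_particle_family u v T \<omega>0 (\<lambda>h\<in>hyps T. \<omega> (\<phi> ` h)))"
    by (rule AE_hyp_measureI)
next
  show "AE (\<omega>0, \<omega>) in M \<Otimes>\<^sub>M hyp_measure M empty_lions. random_particle_family u v empty_lions \<omega>0 \<omega> = tensor_one"
    using branched_charactersD(3)[OF v relabel_in_space]
    by (intro AE_hyp_measureI) (simp only: random_particle_family_eq trunc_lions_forests0_empty relabel_simps empty_lions_simps simp_thms)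
next
  fix T1 T2 assume "T1 \<in> trunc_lions_forests0 \<gamma> \<alpha>" "T2 \<in> trunc_lions_forests0 \<gamma> \<alpha>"
    "nodes T1 \<inter> nodes T2 = {} \<and> lions_prod T1 T2 \<in> trunc_lions_forests \<gamma> \<alpha>"
  then show "AE (\<omega>0, \<omega>) in M \<Otimes>\<^sub>M hyp_measure M (lions_prod T1 T2).
      random_particle_family u v (lions_prod T1 T2) \<omega>0 \<omega> = tensor_prod (nodes T1) (nodes T2)
        (random_particle_family u v T1 \<omega>0 (restrict \<omega> (hyps T1)))
        (random_particle_family u v T2 \<omega>0 (restrict \<omega> (hyps T2)))"
    using trunc_lions_forests_subset[of \<gamma> \<alpha>]
    by (intro AE_hyp_measureI random_particle_family_prod[OF v]) auto
next
  fix T assume "T \<in> trunc_lions_forests \<gamma> \<alpha>" "hyp0 T \<noteq> {}"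
  then show "AE (\<omega>0, \<omega>) in M \<Otimes>\<^sub>M hyp_measure M (decouple T).
      random_particle_family u v T (\<omega> (hyp0 T)) (restrict \<omega> (hyps T)) = random_particle_family u v (decouple T) \<omega>0 \<omega>"
    using trunc_lions_forests_subset[of \<gamma> \<alpha>]
    by (intro AE_hyp_measureI random_particle_family_decouple[OF v]) auto
qed

text \<open>Ancestor-closed sets depend on nodes and edges alone, so both convolutions run over the
  same sets; the factors match because restricting and relabelling commute on the nodes.\<close>

lemma mv_conv_random_particle_family:
  assumes v: "v \<in> branched_characters N \<gamma> \<alpha>" and w: "w \<in> branched_characters N \<gamma> \<alpha>"
    and T: "T \<in> trunc_lions_forests0 \<gamma> \<alpha>"
    and \<omega>0: "\<omega>0 \<in> space M" and \<omega>: "\<omega> \<in> space (hyp_measure M T)"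
  shows "mv_conv (random_particle_family u v) (random_particle_family u w) T \<omega>0 \<omega> =
    branched_conv v w (relabel u (u \<omega>0) T \<omega>)"
proof -
  let ?\<tau> = "relabel u (u \<omega>0) T \<omega>"
  note \<tau> = relabel_in_space[OF T \<omega>0 \<omega>] and P = trunc_lions_forests0D(4)[OF T]
  have restr: "random_particle_family u k (lions_restrict T A) \<omega>0 (pull_vars T A \<omega>) = k (labelled_restrict ?\<tau> A)"
    if k: "k \<in> branched_characters N \<gamma> \<alpha>" and A: "A \<subseteq> nodes T" for k :: "'e labelled_family" and A
  proof -
    let ?\<tau>' = "relabel u (u \<omega>0) (lions_restrict T A) (pull_vars T A \<omega>)"
    have lf: "labelled_restrict ?\<tau> A \<in> labelled_forests N \<gamma> \<alpha>"
      using labelled_forests_restrict[OF \<alpha>_nonneg \<tau>] A by simp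
    have lab: "label ?\<tau>' x = label (labelled_restrict ?\<tau> A) x" if "x \<in> nodes (labelled_restrict ?\<tau> A)" for x
      using label_relabel_restrict[OF P A] that by simp
    \<comment> \<open>Membership comes from the restricted labelled forest, so \<open>A\<close> may
      be any set of nodes, whether or not \<open>lions_restrict T A\<close> is a Lions
      forest.\<close>
    have "?\<tau>' \<in> labelled_forests N \<gamma> \<alpha>"
      using lf lab by (simp add: labelled_forests_def directed_forest_iff)
    from branched_character_cong[OF k lf this _ _ lab] show ?thesis
      by (simp add: random_particle_family_eq)
  qed
  have "ancestor_closed ?\<tau> = ancestor_closed T" by (simp add: ancestor_closed_def)
  moreover have "R \<subseteq> nodes T" if "R \<in> ancestor_closed T" for R using that by (simp add: ancestor_closed_def)
  ultimately show ?thesis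
    unfolding mv_conv_def branched_conv_def using restr[OF v] restr[OF w]
    by (intro ext sum.cong) simp_all
qed

lemma mv_eq_conv_random_particle_family:
  assumes "v \<in> branched_characters N \<gamma> \<alpha>" and "w \<in> branched_characters N \<gamma> \<alpha>"
    and "\<And>\<tau>. \<tau> \<in> labelled_forests N \<gamma> \<alpha> \<Longrightarrow> z \<tau> = branched_conv v w \<tau>"
  shows "mv_eq M \<gamma> \<alpha> (mv_conv (random_particle_family u v) (random_particle_family u w)) (random_particle_family u z)"
  unfolding mv_eq_def using assms mv_conv_random_particle_family[OF assms(1,2)] relabel_in_space
  by (intro ballI AE_hyp_measureI) (simp add: random_particle_family_eq)

lemma mv_eq_random_unit:
  assumes "\<And>\<tau>. \<tau> \<in> labelled_forests N \<gamma> \<alpha> \<Longrightarrow> z \<tau> = branched_unit \<tau>"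
  shows "mv_eq M \<gamma> \<alpha> (random_particle_family u z) mv_unit"
  unfolding mv_eq_def using assms relabel_in_space trunc_lions_forests0D(7)
  by (intro ballI AE_hyp_measureI) (simp add: random_particle_family_eq mv_unit_def branched_unit_def)

end

section \<open>Almost everywhere uniqueness of inverses\<close>

lemma mv_eq_sym: "mv_eq M \<gamma> \<alpha> f g \<Longrightarrow> mv_eq M \<gamma> \<alpha> g f"
  by (simp add: mv_eq_def eq_commute)

lemma mv_eq_trans:
  assumes "mv_eq M \<gamma> \<alpha> f g" and "mv_eq M \<gamma> \<alpha> g k"
  shows "mv_eq M \<gamma> \<alpha> f k"
  unfolding mv_eq_def
proof
  fix T assume "T \<in> trunc_lions_forests0 \<gamma> \<alpha>"
  with assms have "AE (\<omega>0, \<omega>) in M \<Otimes>\<^sub>M hyp_measure M T. f T \<omega>0 \<omega> = g T \<omega>0 \<omega>"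
    "AE (\<omega>0, \<omega>) in M \<Otimes>\<^sub>M hyp_measure M T. g T \<omega>0 \<omega> = k T \<omega>0 \<omega>"
    by (simp_all add: mv_eq_def)
  then show "AE (\<omega>0, \<omega>) in M \<Otimes>\<^sub>M hyp_measure M T. f T \<omega>0 \<omega> = k T \<omega>0 \<omega>"
    by eventually_elim auto
qed

text \<open>\<open>g\<close> witnesses that the choice in \<open>mv_inverse\<close> is not void.
  Both \<open>g\<close> and the chosen family are then right inverses of \<open>f\<close>, and left
  cancellation identifies them.\<close>

lemma (in prob_space) mv_inverse_unique:
  assumes "0 \<le> \<alpha>" and f: "f \<in> mv_characters M \<gamma> \<alpha> q" and g: "g \<in> mv_characters M \<gamma> \<alpha> q"
    and fg: "mv_eq M \<gamma> \<alpha> (mv_conv f g) mv_unit" and gf: "mv_eq M \<gamma> \<alpha> (mv_conv g f) mv_unit"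
  shows "mv_eq M \<gamma> \<alpha> (mv_inverse M \<gamma> \<alpha> q f) g"
proof -
  let ?k = "mv_inverse M \<gamma> \<alpha> q f"
  have "?k \<in> mv_characters M \<gamma> \<alpha> q \<and> mv_eq M \<gamma> \<alpha> (mv_conv f ?k) mv_unit \<and> mv_eq M \<gamma> \<alpha> (mv_conv ?k f) mv_unit"
    unfolding mv_inverse_def by (rule someI[of _ g]) (use g fg gf in simp)
  then show ?thesis
    using mv_conv_left_cancel[OF assms(1) f _ g] mv_eq_trans[OF _ mv_eq_sym[OF fg]] by blast
qed

section \<open>Regularity of the increments\<close>

context particle_space
begin

text \<open>For a fixed labelled forest the constant is uniform in \<open>s\<close> and
  \<open>t\<close>. Integration over \<open>\<omega>\<close> varies the labels, so the constant is
  first made uniform in them as well; it then survives integration against a probability measure,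
  for every \<open>\<omega>0\<close>.\<close>

lemma mv_regular_random_particle_family:
  assumes B: "\<And>s t. s \<in> {0..1} \<Longrightarrow> t \<in> {0..1} \<Longrightarrow> B s t \<in> branched_characters N \<gamma> \<alpha>"
    and bdd: "\<And>\<tau>. \<tau> \<in> labelled_forests N \<gamma> \<alpha> \<Longrightarrow> bdd_above
        {tensor_norm (nodes \<tau>) (B s t \<tau>) / \<bar>t - s\<bar> powr (\<alpha> * real (card (nodes \<tau>))) | s t.
          s \<in> {0..1} \<and> t \<in> {0..1} \<and> s \<noteq> t}"
  shows "mv_regular M \<gamma> \<alpha> (\<lambda>s t. random_particle_family u (B s t))"
  unfolding mv_regular_def
proof (intro ballI AE_I2)
  fix T \<omega>0 assume "T \<in> trunc_lions_forests \<gamma> \<alpha>" and \<omega>0: "\<omega>0 \<in> space M"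
  then have T: "T \<in> trunc_lions_forests0 \<gamma> \<alpha>" using trunc_lions_forests_subset by blast
  let ?k = "\<alpha> * real (card (nodes T))"
  \<comment> \<open>The quotient is multiplied out so that enlarging \<open>C\<close> is harmless
    and integrands can be compared; \<open>s \<noteq> t\<close> keeps the divisor positive when it
    returns.\<close>
  let ?P = "\<lambda>\<tau> C. \<forall>s\<in>{0..1}. \<forall>t\<in>{0..1}. s \<noteq> t \<longrightarrow> tensor_norm (nodes \<tau>) (B s t \<tau>) \<le> C * \<bar>t - s\<bar> powr (\<alpha> * real (card (nodes \<tau>)))"
  have "\<exists>C. ?P \<tau> C" if \<tau>: "\<tau> \<in> labelled_forests N \<gamma> \<alpha>" for \<tau>
  proof -
    obtain C where C: "\<And>x. x \<in> {tensor_norm (nodes \<tau>) (B s t \<tau>) / \<bar>t - s\<bar> powr (\<alpha> * real (card (nodes \<tau>))) | s t.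
          s \<in> {0..1} \<and> t \<in> {0..1} \<and> s \<noteq> t} \<Longrightarrow> x \<le> C"
      using bdd[OF \<tau>] unfolding bdd_above_def by blast
    have "tensor_norm (nodes \<tau>) (B s t \<tau>) \<le> C * \<bar>t - s\<bar> powr (\<alpha> * real (card (nodes \<tau>)))"
      if "s \<in> {0..1}" "t \<in> {0..1}" "s \<noteq> t" for s t
    proof -
      have "0 < \<bar>t - s\<bar> powr (\<alpha> * real (card (nodes \<tau>)))" using that(3) by simp
      moreover have "tensor_norm (nodes \<tau>) (B s t \<tau>) / \<bar>t - s\<bar> powr (\<alpha> * real (card (nodes \<tau>))) \<le> C"
        using that by (intro C) blast
      ultimately show ?thesis by (simp add: pos_divide_le_eq)
    qed
    then show ?thesis by blast
  qed
  moreover have "?P \<tau> C'" if "?P \<tau> C" "C \<le> C'" for \<tau> C C'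
    using that mult_right_mono[OF that(2) powr_ge_zero] by (meson order_trans)
  moreover have "?P \<tau> C" if \<tau>: "\<tau> \<in> labelled_forests N \<gamma> \<alpha>" and "?P (canonical_labelling \<tau>) C" for \<tau> C
  proof -
    have "nodes (canonical_labelling \<tau>) = nodes \<tau>" by (simp add: canonical_labelling_def)
    with that show ?thesis using branched_character_canonical[OF B \<tau>] by simp
  qed
  ultimately obtain C where C: "0 \<le> C"
    "\<And>\<tau>. \<tau> \<in> labelled_forests N \<gamma> \<alpha> \<Longrightarrow> nodes \<tau> = nodes T \<Longrightarrow> edges \<tau> = edges T \<Longrightarrow> ?P \<tau> C"
    using uniform_labelled_bound[OF trunc_lions_forests0D(2)[OF T], of N \<gamma> \<alpha> ?P "edges T"] by blast
  interpret H: prob_space "hyp_measure M T"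
    by (rule prob_space_PiM) (rule prob_space_axioms)
  have "(\<integral>\<^sup>+\<omega>. ennreal (tensor_norm (nodes T) (random_particle_family u (B s t) T \<omega>0 \<omega>)) \<partial>hyp_measure M T) /
      ennreal (\<bar>t - s\<bar> powr ?k) \<le> ennreal C" if st: "s \<in> {0..1}" "t \<in> {0..1}" "s \<noteq> t" for s t
  proof -
    have pos: "0 < \<bar>t - s\<bar> powr ?k" using st(3) by simp
    have "(\<integral>\<^sup>+\<omega>. ennreal (tensor_norm (nodes T) (random_particle_family u (B s t) T \<omega>0 \<omega>)) \<partial>hyp_measure M T)
        \<le> (\<integral>\<^sup>+\<omega>. ennreal (C * \<bar>t - s\<bar> powr ?k) \<partial>hyp_measure M T)"
    proof (intro nn_integral_mono ennreal_leI)
      fix \<omega> assume "\<omega> \<in> space (hyp_measure M T)"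
      from C(2)[OF relabel_in_space[OF T \<omega>0 this]] st
      show "tensor_norm (nodes T) (random_particle_family u (B s t) T \<omega>0 \<omega>) \<le> C * \<bar>t - s\<bar> powr ?k"
        by (simp add: random_particle_family_eq)
    qed
    also have "\<dots> = ennreal (C * \<bar>t - s\<bar> powr ?k)" by (simp add: H.emeasure_space_1)
    finally have "(\<integral>\<^sup>+\<omega>. ennreal (tensor_norm (nodes T) (random_particle_family u (B s t) T \<omega>0 \<omega>)) \<partial>hyp_measure M T) /
      ennreal (\<bar>t - s\<bar> powr ?k) \<le> ennreal (C * \<bar>t - s\<bar> powr ?k) / ennreal (\<bar>t - s\<bar> powr ?k)"
      by (rule divide_right_mono_ennreal)
    also have "\<dots> = ennreal C" using pos C(1) by (simp add: divide_ennreal)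
    finally show ?thesis .
  qed
  then have "(SUP (s, t)\<in>{(s, t). s \<in> {0..1} \<and> t \<in> {0..1} \<and> s \<noteq> t}.
        (\<integral>\<^sup>+\<omega>. ennreal (tensor_norm (nodes T) (random_particle_family u (B s t) T \<omega>0 \<omega>)) \<partial>hyp_measure M T) /
        ennreal (\<bar>t - s\<bar> powr ?k)) \<le> ennreal C"
    by (intro SUP_least) auto
  then show "(SUP (s, t)\<in>{(s, t). s \<in> {0..1} \<and> t \<in> {0..1} \<and> s \<noteq> t}.
        (\<integral>\<^sup>+\<omega>. ennreal (tensor_norm (nodes T) (random_particle_family u (B s t) T \<omega>0 \<omega>)) \<partial>hyp_measure M T) /
        ennreal (\<bar>t - s\<bar> powr ?k)) < \<infinity>"
    by (rule le_less_trans) simp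
qed

end

theorem theorem3p7:
  fixes \<alpha> \<gamma> :: real and N :: nat
    and V :: "real \<Rightarrow> 'd::finite labelled_family"
    and M :: "'w measure" and u :: "'w \<Rightarrow> nat"
    and p q :: "lions_forest \<Rightarrow> nat set \<Rightarrow> real"
    and W :: "real \<Rightarrow> real \<Rightarrow> ('w, 'd) lions_family"
  assumes "0 < \<alpha>" and "\<alpha> \<le> 1"
    and "\<gamma> = (SUP i\<in>{i :: nat. real i * \<alpha> \<le> 1}. real i * \<alpha>)"
    and "real N > \<gamma> / \<alpha>"
    and "branched_rough_path N \<gamma> \<alpha> V"
    and "prob_space M"
    and "u \<in> measurable M (count_space {1..N})"
    and "distr M (count_space {1..N}) u = uniform_count_measure {1..N}"
    and "dual_integrability_functional \<gamma> \<alpha> p q"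
    and "\<And>s t. W s t = random_particle_family u (branched_increment N \<gamma> \<alpha> V s t)"
  shows "(\<forall>s\<in>{0..1}. \<forall>t\<in>{0..1}. W s t \<in> mv_characters M \<gamma> \<alpha> q) \<and>
    (\<forall>s\<in>{0..1}. \<forall>t\<in>{0..1}.
       mv_eq M \<gamma> \<alpha> (W s t) (mv_conv (mv_inverse M \<gamma> \<alpha> q (W 0 s)) (W 0 t))) \<and>
    (\<forall>r\<in>{0..1}. \<forall>s\<in>{0..1}. \<forall>t\<in>{0..1}.
       mv_eq M \<gamma> \<alpha> (mv_conv (W r s) (W s t)) (W r t)) \<and>
    (\<forall>T\<in>trunc_lions_forests \<gamma> \<alpha>. AE \<omega>0 in M.
       (SUP (s, t)\<in>{(s, t). s \<in> {0..1} \<and> t \<in> {0..1} \<and> s \<noteq> t}.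
          (\<integral>\<^sup>+\<omega>. ennreal (tensor_norm (nodes T) (W s t T \<omega>0 \<omega>)) \<partial>hyp_measure M T) /
          ennreal (\<bar>t - s\<bar> powr (\<alpha> * real (card (nodes T))))) < \<infinity>) \<and>
    mv_rough_path M \<gamma> \<alpha> q (\<lambda>t. W 0 t)"
proof -
  let ?B = "branched_increment N \<gamma> \<alpha> V"
  \<comment> \<open>The real supremum is informative only for a bounded set; the index 0 then yields
    \<open>0 \<le> \<gamma>\<close>.\<close>
  have "bdd_above ((\<lambda>i. real i * \<alpha>) ` {i :: nat. real i * \<alpha> \<le> 1})"
    by (rule bdd_aboveI[of _ 1]) auto
  then have "real 0 * \<alpha> \<le> \<gamma>"
    unfolding assms(3) by (intro cSUP_upper) simp_all
  then interpret particle_space M u N \<gamma> \<alpha>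
    using assms(1,6,7) by (simp add: particle_space_def particle_space_axioms_def)
  note rough = assms(5)[unfolded branched_rough_path_def]
  have B: "?B s t \<in> branched_characters N \<gamma> \<alpha>" if "s \<in> {0..1}" "t \<in> {0..1}" for s t
    using rough that by (elim conjE) blast
  have chen: "?B r t \<tau> = branched_conv (?B r s) (?B s t) \<tau>"
    if "r \<in> {0..1}" "s \<in> {0..1}" "t \<in> {0..1}" "\<tau> \<in> labelled_forests N \<gamma> \<alpha>" for r s t \<tau>
    using rough that by (elim conjE) blast
  have bdd: "bdd_above {tensor_norm (nodes \<tau>) (?B s t \<tau>) / \<bar>t - s\<bar> powr (\<alpha> * real (card (nodes \<tau>))) | s t.
          s \<in> {0..1} \<and> t \<in> {0..1} \<and> s \<noteq> t}" if "\<tau> \<in> labelled_forests N \<gamma> \<alpha>" for \<tau>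
    using rough that by (elim conjE) (rule bspec)
  have q: "0 < q T h" if "T \<in> trunc_lions_forests \<gamma> \<alpha>" "h \<in> hyps T" for T h
  proof -
    have "1 < q T h"
      using assms(9)[unfolded dual_integrability_functional_def, THEN conjunct1] that by simp
    then show ?thesis by simp
  qed
  have W: "W s t \<in> mv_characters M \<gamma> \<alpha> q" if "s \<in> {0..1}" "t \<in> {0..1}" for s t
    unfolding assms(10) by (rule random_particle_family_in[OF B[OF that] q])
  have conv: "mv_eq M \<gamma> \<alpha> (mv_conv (W r s) (W s t)) (W r t)"
    if "r \<in> {0..1}" "s \<in> {0..1}" "t \<in> {0..1}" for r s t
    unfolding assms(10)
    by (rule mv_eq_conv_random_particle_family[OF B[OF that(1,2)] B[OF that(2,3)] chen[OF that]])
  \<comment> \<open>Chen's relation with all three times equal makes the increment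
    idempotent.\<close>
  have unit: "mv_eq M \<gamma> \<alpha> (W s s) mv_unit" if "s \<in> {0..1}" for s
    unfolding assms(10)
    by (rule mv_eq_random_unit, rule idempotent_branched_character[OF \<alpha>_nonneg B[OF that that]])
      (use chen[OF that that that] in auto)
  have inc: "mv_eq M \<gamma> \<alpha> (W s t) (mv_conv (mv_inverse M \<gamma> \<alpha> q (W 0 s)) (W 0 t))"
    if s: "s \<in> {0..1}" and t: "t \<in> {0..1}" for s t
  proof -
    have 0: "0 \<in> {0..1::real}" by simp
    \<comment> \<open>The two compositions are \<open>W 0 0\<close> and \<open>W s s\<close>, both
      equal to the unit almost everywhere.\<close>
    have "mv_eq M \<gamma> \<alpha> (mv_inverse M \<gamma> \<alpha> q (W 0 s)) (W s 0)"
      by (rule mv_inverse_unique[OF \<alpha>_nonneg W[OF 0 s] W[OF s 0] mv_eq_trans[OF conv[OF 0 s 0] unit[OF 0]]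
            mv_eq_trans[OF conv[OF s 0 s] unit[OF s]]])
    \<comment> \<open>With \<open>W s 0\<close> in place of the inverse, the product with
      \<open>W 0 t\<close> is \<open>W s t\<close> by Chen's relation through time 0.\<close>
    from mv_eq_trans[OF mv_conv_cong_left[OF \<alpha>_nonneg this] conv[OF s 0 t]] show ?thesis
      by (rule mv_eq_sym)
  qed
  have reg: "mv_regular M \<gamma> \<alpha> W"
  proof -
    have "W = (\<lambda>s t. random_particle_family u (?B s t))" by (intro ext assms(10))
    then show ?thesis using mv_regular_random_particle_family[of ?B, OF B bdd] by simp
  qed
  \<comment> \<open>With \<open>W\<close> as the family of representatives and \<open>W 0 t\<close>
    as the path, the two increment equations in the definition coincide, and both are
    \<open>inc\<close>.\<close>
  have "mv_rough_path M \<gamma> \<alpha> q (\<lambda>t. W 0 t)"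
    unfolding mv_rough_path_def
    by (intro conjI exI[of _ W]) (use W inc conv reg in simp_all)
  with W inc conv reg show ?thesis
    unfolding mv_regular_def by blast
qed

end
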